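(* The synchrotron function $F(x)=x\int_x^\infty K_{5/3}(z)\,dz$, $x>0$, has the following expansion as $x\to0^+$: $$F(x)=2^{2/3}\,\Gamma\!\left(\tfrac23\right)x^{1/3}-\frac{\pi}{\sqrt3}\,x+\frac{3\,\Gamma\!\left(\tfrac23\right)}{4^{5/3}}\,x^{7/3}+\mathcal{O}\!\left(x^{11/3}\right).$$
   Context: $K_\nu$ denotes the modified Bessel function of the second kind, $K_\nu(x)=\frac{\pi}{2}\frac{I_{-\nu}(x)-I_\nu(x)}{\sin(\nu\pi)}$ for non-integer $\nu$ and $x>0$, where $I_\nu$ is the modified Bessel function of the first kind. $\Gamma$ is the Gamma function. *)

theory Defs
  imports "HOL-Analysis.Analysis" "HOL-Library.Landau_Symbols"
begin

definition bessel_I :: "real \<Rightarrow> real \<Rightarrow> real" where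
  "bessel_I \<nu> x = (\<Sum>k. (x / 2) powr (2 * real k + \<nu>) / (fact k * Gamma (real k + \<nu> + 1)))"

(* Meaningful only for x > 0 and non-integer \<nu>; for integer \<nu> the denominator vanishes
   and the value is 0 instead of the limit in \<nu>. When \<nu> is a negative integer, the terms of
   bessel_I at the poles of Gamma vanish, as Gamma is 0 there and division by 0 gives 0. *)
definition bessel_K :: "real \<Rightarrow> real \<Rightarrow> real" where
  "bessel_K \<nu> x = pi / 2 * ((bessel_I (- \<nu>) x - bessel_I \<nu> x) / sin (\<nu> * pi))"

definition synchrotron :: "real \<Rightarrow> real" where
  "synchrotron x = x * integral {x..} (bessel_K (5 / 3))"

end

theory Submission
  imports Defs "HOL-Real_Asymp.Real_Asymp"
begin

text \<open>
  In the variable $w = (x/2)^{2/3}$, the functions $K_{1/3}$ and $K_{2/3}$ are $\sqrt 3\, w^{-1/2} A(w)$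
  and $\sqrt 3\, w^{-1} B(w)$, where $A$ and $B$ are essentially the Airy function and minus its derivative:
  with $\omega = e^{i\pi/3}$, $A$ and $B$ are the imaginary parts of
  $\omega \int_0^\infty e^{-t^3 - 3 w \omega t} dt$ and $\omega^2 \int_0^\infty t\, e^{-t^3 - 3 w \omega t} dt$.
  Expanding $e^{-3w\omega t}$ termwise produces the two Bessel series, since every third term is real and
  Gamma triplication matches the others; comparing $e^{-t^3}$ with $1$ produces the decay at
  infinity, which the Bessel series do not show.

  By the recurrences for $K_\nu$, an antiderivative of $K_{5/3}$ is $\sqrt 3\,(P - 2 B / w)$, where $P' = -3 A$ and
  $P(w)$ is the imaginary part of $\int_0^\infty t^{-1} e^{-t^3 - 3 w \omega t} dt$. As $w \to \infty$, replacing $e^{-t^3}$ by $1$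
  shows that $P(w)$ tends to $-\pi/3$, whence the linear term $-\pi x/\sqrt 3$; the other terms are read
  off the power series of $P$ and $B$.
\<close>

section \<open>Integrating power series against moments\<close>

text \<open>The bound on \<open>a\<close> serves twice: it dominates the series at each t by a
  multiple of the exponential series at \<open>r * t\<close>, and it makes the integrals of the
  absolute terms summable, which allows sum and integral to be exchanged.\<close>

lemma has_bochner_integral_power_series:
  fixes a \<mu> :: "nat \<Rightarrow> real" and f \<rho> :: "real \<Rightarrow> real"
  assumes moment: "\<And>n. has_bochner_integral M (\<lambda>t. t ^ n * \<rho> t) (\<mu> n)"
    and nonneg: "\<And>t. t \<in> space M \<Longrightarrow> 0 \<le> t" "\<And>t. t \<in> space M \<Longrightarrow> 0 \<le> \<rho> t"
    and sums: "\<And>t. t \<in> space M \<Longrightarrow> (\<lambda>n. a n * t ^ n) sums f t"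
    and bound: "\<And>n. \<bar>a n\<bar> \<le> C * (r ^ n / fact n)" and "r \<ge> 0"
    and summable_moments: "summable (\<lambda>n. r ^ n / fact n * \<mu> n)"
  shows "has_bochner_integral M (\<lambda>t. f t * \<rho> t) (\<Sum>n. a n * \<mu> n)"
    and "(\<lambda>n. a n * \<mu> n) sums (\<Sum>n. a n * \<mu> n)"
proof -
  have abs_summable: "summable (\<lambda>n. \<bar>a n\<bar> * t ^ n)" if "t \<in> space M" for t
  proof (rule summable_comparison_test[OF _ summable_mult[OF summable_exp[of "r * t"], of C]])
    have "\<bar>a n\<bar> * t ^ n \<le> C * (r ^ n / fact n) * t ^ n" for n
      using nonneg(1)[OF that] by (intro mult_right_mono bound) auto
    then show "\<exists>N. \<forall>n\<ge>N. norm (\<bar>a n\<bar> * t ^ n) \<le> C * (inverse (fact n) * (r * t) ^ n)"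
      using nonneg(1)[OF that] by (simp add: abs_mult power_mult_distrib divide_inverse mult_ac)
  qed
  have \<mu>_nonneg: "\<mu> n \<ge> 0" for n
    using integral_nonneg_AE[of "\<lambda>t. t ^ n * \<rho> t" M] nonneg
      has_bochner_integral_integral_eq[OF moment, of n] by auto
  have summable: "summable (\<lambda>n. \<bar>a n\<bar> * \<mu> n)"
  proof (rule summable_comparison_test[OF _ summable_mult[OF summable_moments, of C]])
    show "\<exists>N. \<forall>n\<ge>N. norm (\<bar>a n\<bar> * \<mu> n) \<le> C * (r ^ n / fact n * \<mu> n)"
      using mult_right_mono[OF bound \<mu>_nonneg] \<mu>_nonneg by (simp add: abs_mult mult.assoc)
  qed
  define g where "g n t = a n * (t ^ n * \<rho> t)" for n t
  have g: "has_bochner_integral M (g n) (a n * \<mu> n)" for n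
    unfolding g_def by (intro has_bochner_integral_mult_right moment)
  have gi: "integrable M (g n)" for n using g by (rule integrable.intros)
  have gn: "(\<integral>t. norm (g n t) \<partial>M) = \<bar>a n\<bar> * \<mu> n" for n
  proof -
    have "(\<integral>t. norm (g n t) \<partial>M) = (\<integral>t. \<bar>a n\<bar> * (t ^ n * \<rho> t) \<partial>M)"
      using nonneg by (intro Bochner_Integration.integral_cong) (auto simp: g_def abs_mult)
    also have "\<dots> = \<bar>a n\<bar> * \<mu> n"
      by (intro has_bochner_integral_integral_eq has_bochner_integral_mult_right moment)
    finally show ?thesis .
  qed
  have s1: "summable (\<lambda>n. norm (g n t))" if "t \<in> space M" for t
  proof -
    have "(\<lambda>n. norm (g n t)) = (\<lambda>n. (\<bar>a n\<bar> * t ^ n) * \<rho> t)"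
      using nonneg[OF that] by (auto simp: g_def abs_mult)
    then show ?thesis using abs_summable[OF that] by (simp add: summable_mult2)
  qed
  have s2: "(\<Sum>n. g n t) = f t * \<rho> t" if "t \<in> space M" for t
    using sums_unique[OF sums_mult2[OF sums[OF that], of "\<rho> t"]] by (simp add: g_def mult.assoc)
  have AE: "AE t in M. summable (\<lambda>n. norm (g n t))" using s1 by (auto intro: AE_I2)
  have s3: "summable (\<lambda>n. \<integral>t. norm (g n t) \<partial>M)" unfolding gn by (rule summable)
  note * = integrable_suminf[OF gi AE s3] integral_suminf[OF gi AE s3]
  have "has_bochner_integral M (\<lambda>t. \<Sum>n. g n t) (\<Sum>n. a n * \<mu> n)"
    using * has_bochner_integral_integral_eq[OF g] by (simp add: has_bochner_integral_iff)
  then show "has_bochner_integral M (\<lambda>t. f t * \<rho> t) (\<Sum>n. a n * \<mu> n)"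
    using s2 by (subst has_bochner_integral_cong[OF refl _ refl]) auto
  show "(\<lambda>n. a n * \<mu> n) sums (\<Sum>n. a n * \<mu> n)"
    using summable_integral[OF gi AE s3] has_bochner_integral_integral_eq[OF g]
    by (simp add: summable_sums)
qed

text \<open>The substitution u = \<open>c * t ^ p\<close> turns Euler's integral for Gamma at s = (n
  + 1) / p into this moment.\<close>

lemma has_bochner_integral_power_exp_power:
  fixes c :: real and n p :: nat
  assumes "c > 0" "p > 0"
  shows "has_bochner_integral (lebesgue_on {0<..}) (\<lambda>t. t ^ n * exp (- c * t ^ p))
           (Gamma (real (n + 1) / real p) / (real p * c powr (real (n + 1) / real p)))"
proof -
  define s where "s = real (n + 1) / real p"
  have s: "s > 0" using assms by (simp add: s_def)
  let ?f = "\<lambda>u::real. u powr (s - 1) / exp u" and ?g = "\<lambda>t::real. c * t ^ p"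
  let ?g' = "\<lambda>t::real. c * (real p * t ^ (p - 1))"
  have img: "?g ` {0<..} = {0<..}"
  proof (intro equalityI subsetI)
    fix y :: real assume y: "y \<in> {0<..}"
    have "y = ?g (root p (y / c))" using assms y by simp
    moreover have "root p (y / c) \<in> {0<..}" using assms y by simp
    ultimately show "y \<in> ?g ` {0<..}" by blast
  qed (use assms in auto)
  \<comment> \<open>Euler's integral runs over the closed half-line; dropping the null set {0} makes
    the domain the exact image of the substitution.\<close>
  have "(?f has_integral Gamma s) {0<..}"
    using Gamma_integral_real[OF s]
    by (rule has_integral_spike_set_eq[THEN iffD1, rotated 2])
       (auto intro: negligible_subset[of "{0}"])
  \<comment> \<open>The change of variables asks for absolute integrability, which holds because the
    integrand is nonnegative.\<close>
  then have "?f absolutely_integrable_on {0<..} \<and> integral {0<..} ?f = Gamma s"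
    by (auto simp: has_integral_iff intro: nonnegative_absolutely_integrable_1)
  moreover have "(?g has_field_derivative ?g' t) (at t within {0<..})" for t
    by (auto intro!: derivative_eq_intros)
  moreover have "inj_on ?g {0<..}"
    using assms by (auto simp: inj_on_def power_eq_iff_eq_base)
  ultimately have *: "(\<lambda>t. \<bar>?g' t\<bar> * ?f (?g t)) absolutely_integrable_on {0<..}"
       "integral {0<..} (\<lambda>t. \<bar>?g' t\<bar> * ?f (?g t)) = Gamma s"
    using has_absolute_integral_change_of_variables_1'[of "{0<..}" ?g ?g' ?f "Gamma s"] img
    by (simp_all del: One_nat_def)
  have eq: "\<bar>?g' t\<bar> * ?f (?g t) = (real p * c powr s) * (t ^ n * exp (- c * t ^ p))"
    if "t \<in> {0<..}" for t
  proof -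
    have t: "t > 0" using that by simp
    have "t ^ (p - 1) = t powr (real p - 1)"
      using assms t by (simp add: powr_realpow[symmetric] of_nat_diff)
    moreover have "(t ^ p) powr (s - 1) = t powr (real p * (s - 1))"
      using t by (simp add: powr_realpow[symmetric] powr_powr)
    moreover have "real p * (s - 1) = real n + 1 - real p"
      using assms by (simp add: s_def field_simps)
    moreover have "t powr (real p - 1) * t powr (real n + 1 - real p) = t ^ n"
      using t by (simp add: powr_add[symmetric] powr_realpow)
    moreover have "c * c powr (s - 1) = c powr s"
      using assms by (simp add: powr_mult_base)
    ultimately show ?thesis
      using assms t by (simp add: powr_mult exp_minus abs_mult divide_inverse mult_ac)
  qed
  have "integrable (lebesgue_on {0<..}) (\<lambda>t. \<bar>?g' t\<bar> * ?f (?g t))"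
    using *(1) by (simp add: absolutely_integrable_on_def set_integrable_def integrable_restrict_space)
  then have "has_bochner_integral (lebesgue_on {0<..}) (\<lambda>t. \<bar>?g' t\<bar> * ?f (?g t)) (Gamma s)"
    using *(2) by (simp add: has_bochner_integral_iff lebesgue_integral_eq_integral)
  then have "has_bochner_integral (lebesgue_on {0<..})
      (\<lambda>t. (real p * c powr s) * (t ^ n * exp (- c * t ^ p))) (Gamma s)"
    by (subst has_bochner_integral_cong[OF refl _ refl, symmetric]) (use eq in auto)
  then have "has_bochner_integral (lebesgue_on {0<..})
      (\<lambda>t. (real p * c powr s) * (t ^ n * exp (- c * t ^ p)) / (real p * c powr s))
      (Gamma s / (real p * c powr s))"
    by (intro has_bochner_integral_divide_zero)
  then show ?thesis using assms by (simp add: s_def)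
qed

section \<open>Bessel series\<close>

text \<open>
  The Bessel--Clifford function. With \<open>rGamma\<close> in place of a quotient by \<open>Gamma\<close>, its recurrence
  holds for every real \<open>c\<close>.
\<close>

definition clifford :: "real \<Rightarrow> real \<Rightarrow> real" where
  "clifford c y = (\<Sum>k. rGamma (real k + c) / fact k * y ^ k)"

text \<open>Once z = k + c is at least 1, \<open>rGamma z = z * rGamma (z + 1)\<close> makes the
  absolute values nonincreasing; the finitely many earlier terms do not affect boundedness.\<close>

lemma Bseq_rGamma_add_nat: "Bseq (\<lambda>k. rGamma (real k + c :: real))"
proof -
  obtain N :: nat where N: "real N + c \<ge> 1"
    using real_arch_simple[of "1 - c"] by (auto simp: algebra_simps)
  have "\<bar>rGamma (real (k + N) + c)\<bar> \<le> \<bar>rGamma (real N + c)\<bar>" for k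
  proof (induction k)
    case (Suc k)
    let ?z = "real (k + N) + c"
    have "1 * \<bar>rGamma (?z + 1)\<bar> \<le> \<bar>?z\<bar> * \<bar>rGamma (?z + 1)\<bar>"
      using N by (intro mult_right_mono) auto
    also have "\<dots> = \<bar>rGamma ?z\<bar>"
      by (metis abs_mult rGamma_plus1)
    finally show ?case using Suc by (simp add: algebra_simps)
  qed simp
  then have "Bseq (\<lambda>k. rGamma (real (k + N) + c))"
    by (intro BseqI') auto
  then show ?thesis by (rule Bseq_offset)
qed

lemma summable_clifford: "summable (\<lambda>k. rGamma (real k + c) / fact k * y ^ k)"
proof -
  obtain B where B: "\<And>k. \<bar>rGamma (real k + c)\<bar> \<le> B"
    using Bseq_rGamma_add_nat[of c] by (auto simp: Bseq_def)
  show ?thesis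
  proof (rule summable_comparison_test[OF _ summable_mult[OF summable_exp[of "\<bar>y\<bar>"], of B]])
    show "\<exists>N. \<forall>k\<ge>N. norm (rGamma (real k + c) / fact k * y ^ k) \<le> B * (inverse (fact k) * \<bar>y\<bar> ^ k)"
      using mult_right_mono[OF B, of "\<bar>y\<bar> ^ k / fact k" for k]
      by (auto simp: abs_mult power_abs field_simps)
  qed
qed

lemma clifford_sums: "(\<lambda>k. rGamma (real k + c) / fact k * y ^ k) sums clifford c y"
  unfolding clifford_def using summable_clifford by (rule summable_sums)

text \<open>Termwise differentiation shifts the index by one and cancels one factor of the
  factorial, which amounts to raising the parameter by one.\<close>

lemma clifford_has_real_derivative [derivative_intros]:
  assumes "(f has_real_derivative f') (at x within S)"
  shows "((\<lambda>x. clifford c (f x)) has_real_derivative clifford (c + 1) (f x) * f') (at x within S)"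
proof -
  have "diffs (\<lambda>k. rGamma (real k + c) / fact k) = (\<lambda>k. rGamma (real k + (c + 1)) / fact k)"
    by (auto simp: diffs_def fun_eq_iff field_simps simp del: of_nat_Suc)
       (auto simp: algebra_simps)
  then have "(clifford c has_real_derivative clifford (c + 1) y) (at y)" for y
    using termdiffs_strong_converges_everywhere[OF summable_clifford, of c y]
    unfolding clifford_def[abs_def] by simp
  from DERIV_chain2[OF this assms] show ?thesis .
qed

text \<open>Write each coefficient through \<open>rGamma z = z * rGamma (z + 1)\<close> with z = k +
  c. The summand c of z gives the first term; the summand k cancels against the factorial and gives
  the second. This is the three-term Bessel recurrence in the present normalisation.\<close>

lemma clifford_recurrence: "clifford c y = c * clifford (c + 1) y + y * clifford (c + 2) y"
proof -
  have "(\<lambda>k. real (Suc k) * (rGamma (real (Suc k) + (c + 1)) / fact (Suc k) * y ^ Suc k))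
          sums (y * clifford (c + 2) y)"
    using sums_mult[OF clifford_sums[of "c + 2" y], of y]
    by (simp add: field_simps del: of_nat_Suc) (simp add: algebra_simps)
  \<comment> \<open>Undoing the index shift adds only a term at k = 0, which the factor k
    annihilates.\<close>
  then have "(\<lambda>k. real k * (rGamma (real k + (c + 1)) / fact k * y ^ k)) sums (y * clifford (c + 2) y)"
    by (subst (asm) sums_Suc_iff) simp
  from sums_add[OF sums_mult[OF clifford_sums[of "c + 1" y], of c] this]
  have "(\<lambda>k. (real k + c) * rGamma (real k + c + 1) / fact k * y ^ k)
          sums (c * clifford (c + 1) y + y * clifford (c + 2) y)"
    by (simp add: algebra_simps add_divide_distrib)
  then have "(\<lambda>k. rGamma (real k + c) / fact k * y ^ k) sums (c * clifford (c + 1) y + y * clifford (c + 2) y)"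
    by (simp add: rGamma_plus1)
  with clifford_sums show ?thesis by (rule sums_unique2)
qed

text \<open>For positive x the power splits into an even part and a common factor. At poles of Gamma
  both sides still agree: there \<open>Gamma\<close> is 0, so the quotient is 0, as is
  \<open>rGamma\<close>.\<close>

lemma bessel_I_eq_clifford:
  assumes "x > 0"
  shows "bessel_I \<nu> x = (x / 2) powr \<nu> * clifford (\<nu> + 1) ((x / 2)\<^sup>2)"
proof -
  have "(x / 2) powr (2 * real k + \<nu>) / (fact k * Gamma (real k + \<nu> + 1)) =
        (x / 2) powr \<nu> * (rGamma (real k + (\<nu> + 1)) / fact k * ((x / 2)\<^sup>2) ^ k)" for k
  proof -
    have "(x / 2) powr (2 * real k + \<nu>) = (x / 2) powr \<nu> * (x / 2) powr real (2 * k)"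
      by (simp add: powr_add mult.commute)
    also have "(x / 2) powr real (2 * k) = ((x / 2)\<^sup>2) ^ k"
      using assms by (simp add: powr_realpow power_mult del: of_nat_mult)
    moreover have "a * b / (f * g) = a * (inverse g / f * b)" for a b f g :: real
      by (simp add: field_simps)
    moreover have "real k + \<nu> + 1 = real k + (\<nu> + 1)" by simp
    ultimately show ?thesis by (simp only: rGamma_inverse_Gamma)
  qed
  then show ?thesis
    unfolding bessel_I_def clifford_def by (simp only: suminf_mult[OF summable_clifford])
qed

text \<open>The remainder is y^N times a power series that again converges everywhere, hence is
  continuous and so bounded near 0.\<close>

lemma powser_minus_partial_sum_bigo:
  fixes a :: "nat \<Rightarrow> real"
  assumes "\<And>y. summable (\<lambda>n. a n * y ^ n)"
  shows "(\<lambda>y. (\<Sum>n. a n * y ^ n) - (\<Sum>n<N. a n * y ^ n)) \<in> O[at 0](\<lambda>y. y ^ N)"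
proof -
  have s: "summable (\<lambda>n. a (n + N) * y ^ n)" for y
  proof (cases "y = 0")
    case True
    then show ?thesis by (auto intro!: summable_finite[of "{0}"])
  next
    case False
    have "(\<lambda>n. a (n + N) * y ^ n) = (\<lambda>n. a (n + N) * y ^ (n + N) / y ^ N)"
      using False by (auto simp: power_add)
    then show ?thesis
      using summable_divide[OF summable_ignore_initial_segment[OF assms, of N y], of "y ^ N"]
      by (simp only:)
  qed
  define g where "g y = (\<Sum>n. a (n + N) * y ^ n)" for y
  have "(g has_field_derivative (\<Sum>n. diffs (\<lambda>n. a (n + N)) n * 0 ^ n)) (at 0)"
    unfolding g_def[abs_def] by (rule termdiffs_strong_converges_everywhere[OF s])
  then have "(g \<longlongrightarrow> g 0) (at 0)" using DERIV_isCont isContD by blast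
  then have "g \<in> O[at 0](\<lambda>_. 1)" by (intro bigoI_tendsto[where c = "g 0"]) auto
  then have "(\<lambda>y. y ^ N * g y) \<in> O[at 0](\<lambda>y. y ^ N * 1)" by (intro landau_o.big.mult) auto
  moreover have "(\<Sum>n. a n * y ^ n) - (\<Sum>n<N. a n * y ^ n) = y ^ N * g y" for y
    using suminf_split_initial_segment[OF assms, of y N] suminf_mult[OF s, of "y ^ N" y]
    by (simp add: g_def power_add mult_ac)
  ultimately show ?thesis by simp
qed

section \<open>The triplication formula\<close>

text \<open>Euler's reflection formula at 1/3, taken over the complex numbers and pulled back to the
  reals.\<close>

lemma Gamma_one_third_two_thirds: "Gamma (1 / 3) * Gamma (2 / 3 :: real) = 2 * pi / sqrt 3"
proof -
  have "complex_of_real (Gamma (1 / 3) * Gamma (2 / 3)) = Gamma (1 / 3) * Gamma (1 - 1 / 3)"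
    by (simp flip: Gamma_complex_of_real)
  also have "\<dots> = complex_of_real (pi / sin (pi / 3))"
    by (subst Gamma_reflection_complex) (simp flip: sin_of_real)
  finally show ?thesis
    by (subst (asm) of_real_eq_iff) (simp add: sin_60)
qed

lemma Gamma_plus1_pos: "z > 0 \<Longrightarrow> Gamma (z + 1) = z * Gamma (z :: real)"
  by (rule Gamma_plus1) (auto elim!: nonpos_Ints_cases)

lemma Gamma_four_thirds: "Gamma (4 / 3 :: real) = Gamma (1 / 3) / 3"
  using Gamma_plus1_pos[of "1 / 3"] by simp

lemma Gamma_five_thirds: "Gamma (5 / 3 :: real) = 2 / 3 * Gamma (2 / 3)"
  using Gamma_plus1_pos[of "2 / 3"] by simp

text \<open>Gauss's multiplication formula for three factors at (n + 1) / 3. Passing from m to m + 3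
  raises each Gamma argument by one and divides both sides by \<open>z2 * z3\<close>; the three
  initial cases reduce to the product of Gamma (1/3) and Gamma (2/3).\<close>

lemma Gamma_triplication_nat:
  "3 ^ n * Gamma (real (n + 1) / 3) / fact n =
     2 * pi / sqrt 3 * (rGamma (real (n + 2) / 3) * rGamma (real (n + 3) / 3))"
proof (induction n rule: less_induct)
  case (less n)
  have pos: "Gamma (1 / 3 :: real) > 0" "Gamma (2 / 3 :: real) > 0" by (auto intro: Gamma_real_pos)
  have G: "2 * pi / sqrt 3 * rGamma (2 / 3) = Gamma (1 / 3 :: real)"
    "2 * pi / sqrt 3 * rGamma (1 / 3) = Gamma (2 / 3 :: real)"
    unfolding Gamma_one_third_two_thirds[symmetric] using pos[THEN less_imp_neq] by (simp_all add: rGamma_inverse_Gamma)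
  have r: "rGamma (4 / 3 :: real) = 3 * rGamma (1 / 3)" "rGamma (5 / 3 :: real) = 3 / 2 * rGamma (2 / 3)"
    using rGamma_plus1[of "1 / 3 :: real"] rGamma_plus1[of "2 / 3 :: real"] by auto
  have "n = 0 \<or> n = 1 \<or> n = 2 \<or> n = (n - 3) + 3" by arith
  then consider "n = 0" | "n = 1" | "n = 2" | m where "n = m + 3" by blast
  then show ?case
  proof cases
    case 1
    then show ?thesis using G(1) by simp
  next
    case 2
    have "2 * pi / sqrt 3 * (rGamma 1 * rGamma (4 / 3)) = 3 * (2 * pi / sqrt 3 * rGamma (1 / 3 :: real))"
      by (simp add: r)
    also have "\<dots> = 3 * Gamma (2 / 3)" unfolding G ..
    finally show ?thesis using 2 by simp
  next
    case 3
    have "2 * pi / sqrt 3 * (rGamma (4 / 3) * rGamma (5 / 3)) =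
          9 / 2 * (2 * pi / sqrt 3 * rGamma (1 / 3 :: real)) * rGamma (2 / 3)"
      by (simp add: r)
    also have "\<dots> = 9 / 2" unfolding G using pos(2)[THEN less_imp_neq] by (simp add: rGamma_inverse_Gamma)
    finally show ?thesis using 3 by (simp add: fact_numeral)
  next
    case (4 m)
    define z1 z2 z3 where "z1 = real (m + 1) / 3" and "z2 = real (m + 2) / 3" and "z3 = real (m + 3) / 3"
    have pos: "z1 > 0" "z2 > 0" "z3 > 0" by (auto simp: z1_def z2_def z3_def)
    have "fact n = real (m + 3) * real (m + 2) * real (m + 1) * fact m"
      using 4 by (simp add: numeral_3_eq_3 del: of_nat_Suc)
    then have f: "fact n = (27 * z1 * z2 * z3 :: real) * fact m"
      by (simp add: z1_def z2_def z3_def)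
    have Gz: "Gamma (z1 + 1) = z1 * Gamma z1"
      using pos by (intro Gamma_plus1_pos)
    have rz: "rGamma (z2 + 1) = rGamma z2 / z2" "rGamma (z3 + 1) = rGamma z3 / z3"
      using rGamma_plus1[of z2] rGamma_plus1[of z3] pos by (simp_all add: nonzero_eq_divide_eq mult.commute)
    have IH: "3 ^ m * Gamma z1 / fact m = 2 * pi / sqrt 3 * (rGamma z2 * rGamma z3)"
      using less[of m] 4 by (simp add: z1_def z2_def z3_def)
    have "3 ^ n * Gamma (z1 + 1) / fact n = (3 ^ m * Gamma z1 / fact m) / (z2 * z3)"
      using pos 4 unfolding f Gz by (simp add: power_add field_simps)
    also have "\<dots> = 2 * pi / sqrt 3 * (rGamma (z2 + 1) * rGamma (z3 + 1))"
      unfolding IH rz by simp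
    finally show ?thesis
      using 4 by (simp add: z1_def z2_def z3_def add_divide_distrib add_ac)
  qed
qed

section \<open>Powers of the sixth root of unity, and splitting series modulo three\<close>

abbreviation \<omega> :: complex where "\<omega> \<equiv> cis (pi / 3)"

lemma \<omega>_power3: "\<omega> ^ 3 = -1" by (simp add: Complex.DeMoivre)

text \<open>As the cube of \<open>\<omega>\<close> is -1, the imaginary parts repeat with period
  three up to sign. The vanishing class is the reason why only two Bessel series appear.\<close>

lemma Im_\<omega>_power: "Im (\<omega> ^ (3 * k)) = 0" "Im (\<omega> ^ (3 * k + 1)) = (-1) ^ k * (sqrt 3 / 2)"
  "Im (\<omega> ^ (3 * k + 2)) = (-1) ^ k * (sqrt 3 / 2)"
proof -
  have "\<omega> ^ (3 * k + j) = of_real ((-1) ^ k) * \<omega> ^ j" for j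
    by (simp add: power_add power_mult \<omega>_power3)
  then have "Im (\<omega> ^ (3 * k + j)) = (-1) ^ k * sin (real j * pi / 3)" for j
    by (simp add: Complex.DeMoivre Im_power_real)
  from this[of 0] this[of 1] this[of 2]
  show "Im (\<omega> ^ (3 * k)) = 0" "Im (\<omega> ^ (3 * k + 1)) = (-1) ^ k * (sqrt 3 / 2)"
    "Im (\<omega> ^ (3 * k + 2)) = (-1) ^ k * (sqrt 3 / 2)"
    by (simp_all add: sin_60 sin_120)
qed

text \<open>Grouping by residue lets each surviving class be recognised as a Bessel--Clifford
  series.\<close>

lemma sums_mod3:
  fixes f :: "nat \<Rightarrow> real"
  assumes "f sums s"
  shows "(\<lambda>k. f (3 * k) + f (3 * k + 1) + f (3 * k + 2)) sums s"
proof -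
  have "{k * 3..<k * 3 + 3} = {3 * k, 3 * k + 1, 3 * k + 2}" for k :: nat by auto
  then show ?thesis using sums_group[OF assms, of 3] by (simp add: add.assoc)
qed

section \<open>Moments of exponential weights\<close>

lemma has_bochner_integral_power_exp:
  fixes c :: real
  assumes "c > 0"
  shows "has_bochner_integral (lebesgue_on {0<..}) (\<lambda>t. t ^ n * exp (- c * t)) (fact n / c ^ (n + 1))"
proof -
  have "Gamma (real (n + 1)) = fact n" using Gamma_fact[of n, where 'a = real] by (simp add: add.commute)
  moreover have "c powr real (n + 1) = c ^ (n + 1)" using assms by (rule powr_realpow)
  ultimately show ?thesis
    using has_bochner_integral_power_exp_power[OF assms, of 1 n] by simp
qed

lemma has_bochner_integral_power_exp_cube:
  "has_bochner_integral (lebesgue_on {0<..}) (\<lambda>t. t ^ n * exp (- (t ^ 3))) (Gamma (real (n + 1) / 3) / 3)"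
  using has_bochner_integral_power_exp_power[of 1 3 n] by simp

lemma power_div_fact_le_exp:
  assumes "x \<ge> (0 :: real)"
  shows "x ^ n / fact n \<le> exp x"
proof -
  have "sum (\<lambda>n. inverse (fact n) * x ^ n) {n} \<le> (\<Sum>n. inverse (fact n) * x ^ n)"
    using assms by (intro sum_le_suminf summable_exp) auto
  then show ?thesis by (simp add: exp_def divide_inverse mult.commute)
qed

text \<open>Replacing r by 2 r still leaves the terms bounded, since they are dominated by the
  integral of exp (2 r t - t^3). Going back to r gains a factor 2^(-n), so a geometric series
  dominates.\<close>

lemma summable_cube_moments:
  assumes "r \<ge> 0"
  shows "summable (\<lambda>n. r ^ n / fact n * (Gamma (real (n + 1) / 3) / 3))"
proof -
  \<comment> \<open>The extra 1 pays for the integrable factor exp (-t) left on the right-hand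
    side.\<close>
  define S where "S = 2 * r + 1"
  have bound: "(2 * r) ^ n / fact n * (Gamma (real (n + 1) / 3) / 3) \<le> exp (S\<^sup>2)" for n
  proof -
    have 1: "has_bochner_integral (lebesgue_on {0<..}) (\<lambda>t. (2 * r) ^ n / fact n * (t ^ n * exp (- (t ^ 3))))
               ((2 * r) ^ n / fact n * (Gamma (real (n + 1) / 3) / 3))"
      by (intro has_bochner_integral_mult_right has_bochner_integral_power_exp_cube)
    have 2: "has_bochner_integral (lebesgue_on {0<..}) (\<lambda>t. exp (S\<^sup>2) * (t ^ 0 * exp (- 1 * t))) (exp (S\<^sup>2) * (fact 0 / 1 ^ (0 + 1)))"
      by (intro has_bochner_integral_mult_right has_bochner_integral_power_exp) auto
    have "(2 * r) ^ n / fact n * (t ^ n * exp (- (t ^ 3))) \<le> exp (S\<^sup>2) * (t ^ 0 * exp (- 1 * t))"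
      if "t > 0" for t
    proof -
      \<comment> \<open>Up to S the square of S suffices; beyond it, t exceeds S and hence 1, so t^3
        does.\<close>
      have "S * t \<le> S\<^sup>2 + t ^ 3"
      proof (cases "t \<le> S")
        case True
        then have "S * t \<le> S * S" using assms by (intro mult_left_mono) (auto simp: S_def)
        then show ?thesis using that by (auto simp: power2_eq_square intro: order_trans)
      next
        case False
        then have "S * t \<le> t * t" using that by (intro mult_right_mono) auto
        also have "\<dots> \<le> t * t * t" using False that assms by (intro mult_le_cancel_left1[THEN iffD2]) (auto simp: S_def)
        also have "\<dots> \<le> S\<^sup>2 + t ^ 3" by (simp add: power3_eq_cube)
        finally show ?thesis .
      qed
      then have "2 * r * t - t ^ 3 \<le> S\<^sup>2 - t" by (simp add: S_def algebra_simps)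
      then have "exp (2 * r * t) * exp (- (t ^ 3)) \<le> exp (S\<^sup>2) * exp (- t)"
        by (simp add: exp_add[symmetric])
      moreover have "(2 * r * t) ^ n / fact n * exp (- (t ^ 3)) \<le> exp (2 * r * t) * exp (- (t ^ 3))"
        using assms that by (intro mult_right_mono power_div_fact_le_exp) auto
      ultimately show ?thesis by (simp add: power_mult_distrib)
    qed
    then have "(2 * r) ^ n / fact n * (Gamma (real (n + 1) / 3) / 3) \<le> exp (S\<^sup>2) * (fact 0 / 1 ^ (0 + 1))"
      using integral_mono[OF 1[THEN integrable.intros] 2[THEN integrable.intros]]
        has_bochner_integral_integral_eq[OF 1] has_bochner_integral_integral_eq[OF 2] by auto
    then show ?thesis by simp
  qed
  have "summable (\<lambda>n. exp (S\<^sup>2) * (1 / 2) ^ n)" by (intro summable_mult summable_geometric) auto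
  then show ?thesis
  proof (rule summable_comparison_test[rotated], intro exI allI impI)
    fix n
    have "Gamma (real (n + 1) / 3) > 0" by (intro Gamma_real_pos) auto
    then show "norm (r ^ n / fact n * (Gamma (real (n + 1) / 3) / 3)) \<le> exp (S\<^sup>2) * (1 / 2) ^ n"
      using bound[of n] assms by (simp add: power_mult_distrib field_simps abs_mult)
  qed
qed

lemma summable_mult_cube_moments:
  assumes bound: "\<And>n. \<bar>a n\<bar> \<le> C * (r ^ n / fact n)" and "r \<ge> 0"
  shows "summable (\<lambda>n. a n * (Gamma (real (n + 1) / 3) / 3))"
proof (rule summable_comparison_test[OF _ summable_mult[OF summable_cube_moments[OF assms(2)], of C]], intro exI allI impI)
  fix n
  have "Gamma (real (n + 1) / 3) > 0" by (intro Gamma_real_pos) auto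
  then have "norm (a n * (Gamma (real (n + 1) / 3) / 3)) = \<bar>a n\<bar> * (Gamma (real (n + 1) / 3) / 3)"
    by (simp add: abs_mult)
  also have "\<dots> \<le> C * (r ^ n / fact n) * (Gamma (real (n + 1) / 3) / 3)"
    using \<open>Gamma (real (n + 1) / 3) > 0\<close> by (intro mult_right_mono bound) auto
  finally show "norm (a n * (Gamma (real (n + 1) / 3) / 3)) \<le> C * (r ^ n / fact n * (Gamma (real (n + 1) / 3) / 3))"
    by (simp only: mult.assoc)
qed

section \<open>Power series of the integrands, and comparison with exponential moments\<close>

lemma Im_exp_sums: "(\<lambda>n. Im (u * z ^ n) / fact n * t ^ n) sums Im (u * exp (z * of_real t))"
proof -
  have "(\<lambda>n. Im (u * ((z * of_real t) ^ n /\<^sub>R fact n))) sums Im (u * exp (z * of_real t))"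
    by (intro sums_Im sums_mult exp_converges)
  moreover have "Im (u * ((z * of_real t) ^ n /\<^sub>R fact n)) = Im (u * z ^ n) / fact n * t ^ n" for n
  proof -
    have "u * ((z * of_real t) ^ n /\<^sub>R fact n) = of_real (t ^ n / fact n) * (u * z ^ n)"
      by (simp add: power_mult_distrib scaleR_conv_of_real divide_inverse)
    then show ?thesis by (simp add: mult.commute del: of_real_divide of_real_power)
  qed
  ultimately show ?thesis by simp
qed

text \<open>The constant term of the exponential series is real, so after taking imaginary parts
  division by t still leaves a power series.\<close>

lemma Im_exp_div_sums:
  assumes "t \<noteq> 0"
  shows "(\<lambda>n. Im (z ^ Suc n) / fact (Suc n) * t ^ n) sums (Im (exp (z * of_real t)) / t)"
proof -
  have "(\<lambda>n. Im (z ^ Suc n) / fact (Suc n) * t ^ Suc n) sums Im (exp (z * of_real t))"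
    using Im_exp_sums[of 1 z t] by (subst sums_Suc_iff) simp
  from sums_divide[OF this, of t] assms show ?thesis by (simp del: fact_Suc)
qed

text \<open>Absorbing the factor t into the series, rather than into the weight, keeps the moments
  the same for all three integrals. At n = 0 the truncated \<open>n - 1\<close> is harmless because
  of the factor n.\<close>

lemma mult_Im_exp_sums:
  "(\<lambda>n. real n * Im (u * z ^ (n - 1)) / fact n * t ^ n) sums (t * Im (u * exp (z * of_real t)))"
proof -
  have "(\<lambda>n. t * (Im (u * z ^ n) / fact n * t ^ n)) sums (t * Im (u * exp (z * of_real t)))"
    by (intro sums_mult Im_exp_sums)
  also have "(\<lambda>n. t * (Im (u * z ^ n) / fact n * t ^ n)) =
      (\<lambda>n. real (Suc n) * Im (u * z ^ (Suc n - 1)) / fact (Suc n) * t ^ Suc n)"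
    by (simp add: fun_eq_iff)
  finally show ?thesis by (subst (asm) sums_Suc_iff) simp
qed

lemma abs_Im_mult_power_le: "\<bar>Im (u * z ^ n)\<bar> \<le> norm u * norm z ^ n"
  using abs_Im_le_cmod[of "u * z ^ n"] by (simp add: norm_mult norm_power)

lemma abs_has_bochner_integral_le:
  fixes f :: "real \<Rightarrow> real" and c I :: real
  assumes "has_bochner_integral (lebesgue_on {0<..}) f I" "c > 0"
    and "\<And>t. t > 0 \<Longrightarrow> \<bar>f t\<bar> \<le> t ^ n * exp (- c * t)"
  shows "\<bar>I\<bar> \<le> fact n / c ^ (n + 1)"
proof -
  note g = has_bochner_integral_power_exp[OF assms(2), of n]
  have "norm (integral\<^sup>L (lebesgue_on {0<..}) f) \<le> integral\<^sup>L (lebesgue_on {0<..}) (\<lambda>t. t ^ n * exp (- c * t))"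
    by (rule Bochner_Integration.integral_norm_bound_integral) (use assms g in \<open>auto intro: integrable.intros\<close>)
  then show ?thesis
    using has_bochner_integral_integral_eq[OF assms(1)] has_bochner_integral_integral_eq[OF g] by simp
qed

section \<open>Airy-type series\<close>

text \<open>
  In terms of the Airy function, \<open>airy_value w\<close> is $3^{-1/3} \pi \mathrm{Ai}(3^{2/3} w)$ and
  \<open>airy_slope w\<close> is $-3^{-2/3} \pi \mathrm{Ai}'(3^{2/3} w)$.
\<close>

definition airy_value :: "real \<Rightarrow> real" where
  "airy_value w = pi / 3 * (clifford (2 / 3) (w ^ 3) - w * clifford (4 / 3) (w ^ 3))"

definition airy_slope :: "real \<Rightarrow> real" where
  "airy_slope w = pi / 3 * (clifford (1 / 3) (w ^ 3) - w\<^sup>2 * clifford (5 / 3) (w ^ 3))"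

text \<open>The n-th moment of exp (-t^3) times the coefficient of t^n in Im (exp (-3
  \<open>\<omega>\<close> t)) / t; the index is shifted by one because the constant term of the
  exponential is real.\<close>

definition airy_primitive_coeff :: "nat \<Rightarrow> real" where
  "airy_primitive_coeff n = Im ((-3 * \<omega>) ^ Suc n) / fact (Suc n) * (Gamma (real (n + 1) / 3) / 3)"

definition airy_primitive :: "real \<Rightarrow> real" where
  "airy_primitive w = (\<Sum>n. airy_primitive_coeff n * w ^ Suc n)"

lemma real_3k: "real (3 * k + 1) / 3 = real k + 1 / 3" "real (3 * k + 2) / 3 = real k + 2 / 3"
  "real (3 * k + 3) / 3 = real k + 1" "real (3 * k + 4) / 3 = real k + 4 / 3"
  "real (3 * k + 5) / 3 = real k + 5 / 3"
  by (simp_all add: field_simps)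

lemma rGamma_real_add_one: "rGamma (real k + 1) = 1 / fact k"
  using Gamma_fact[of k, where 'a = real] by (simp add: rGamma_inverse_Gamma divide_inverse add.commute)

lemma Im_\<omega>_mult_power: "Im (\<omega> ^ j * (of_real a * \<omega>) ^ n) = a ^ n * Im (\<omega> ^ (n + j))"
proof -
  have "\<omega> ^ j * (of_real a * \<omega>) ^ n = of_real (a ^ n) * \<omega> ^ (n + j)"
    unfolding power_mult_distrib power_add of_real_power by (simp only: mult_ac)
  then show ?thesis by (simp del: of_real_power)
qed

lemma abs_Im_\<omega>_mult_power_le: "\<bar>Im (\<omega> ^ j * (of_real a * \<omega>) ^ n)\<bar> \<le> \<bar>a\<bar> ^ n"
  using abs_Im_mult_power_le[of "\<omega> ^ j" "of_real a * \<omega>" n] by (simp add: norm_mult norm_power)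

lemma airy_value_coeff_le:
  "\<bar>Im (\<omega> * (of_real (-3 * w) * \<omega>) ^ n) / fact n\<bar> \<le> 1 * ((3 * \<bar>w\<bar>) ^ n / fact n)"
  using abs_Im_\<omega>_mult_power_le[of 1 "-3 * w" n] by (simp add: abs_mult divide_right_mono)

text \<open>The factor n is absorbed by n < 2^n. Adding 1 to 3 |w| makes the base at least 1, so
  that the exponent n - 1 may be raised to n.\<close>

lemma airy_slope_coeff_le:
  "\<bar>real n * Im (\<omega>\<^sup>2 * (of_real (-3 * w) * \<omega>) ^ (n - 1)) / fact n\<bar> \<le> 1 * ((2 * (3 * \<bar>w\<bar> + 1)) ^ n / fact n)"
proof -
  let ?r = "3 * \<bar>w\<bar> + 1"
  have "\<bar>Im (\<omega>\<^sup>2 * (of_real (-3 * w) * \<omega>) ^ (n - 1))\<bar> \<le> (3 * \<bar>w\<bar>) ^ (n - 1)"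
    using abs_Im_\<omega>_mult_power_le[of 2 "-3 * w" "n - 1"] by (simp add: abs_mult)
  also have "\<dots> \<le> ?r ^ (n - 1)" by (intro power_mono) auto
  also have "\<dots> \<le> ?r ^ n" by (intro power_increasing) auto
  finally have "real n * \<bar>Im (\<omega>\<^sup>2 * (of_real (-3 * w) * \<omega>) ^ (n - 1))\<bar> \<le> 2 ^ n * ?r ^ n"
    using of_nat_less_two_power[of n, where 'a = real] by (intro mult_mono) auto
  then show ?thesis by (simp only: abs_mult abs_divide power_mult_distrib) (simp add: divide_right_mono)
qed

lemma airy_primitive_coeff_le:
  "\<bar>Im ((of_real a * \<omega>) ^ Suc n) / fact (Suc n)\<bar> \<le> \<bar>a\<bar> * (\<bar>a\<bar> ^ n / fact n)"
proof -
  have "\<bar>Im ((of_real a * \<omega>) ^ Suc n)\<bar> / fact (Suc n) \<le> \<bar>a\<bar> ^ Suc n / fact n"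
    using abs_Im_\<omega>_mult_power_le[of 0 a "Suc n"] by (intro frac_le fact_mono) (auto simp del: fact_Suc power_Suc)
  then show ?thesis by (simp del: fact_Suc add: abs_divide)
qed

text \<open>By triplication each term carries two reciprocal Gammas, one of which becomes 1 / k! in
  residue classes 0 and 1 of n modulo 3. These give the two Bessel--Clifford series, the signs of
  (-w)^n and of the imaginary parts combining; class 2 drops out.\<close>

lemma airy_value_sums:
  "(\<lambda>n. Im (\<omega> * (of_real (-3 * w) * \<omega>) ^ n) / fact n * (Gamma (real (n + 1) / 3) / 3)) sums airy_value w"
  (is "?f sums _")
proof -
  have f: "?f n = (- w) ^ n * Im (\<omega> ^ (n + 1)) *
      (2 * pi / (3 * sqrt 3) * (rGamma (real (n + 2) / 3) * rGamma (real (n + 3) / 3)))" for n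
  proof -
    have "(-3 * w) ^ n = (- w) ^ n * 3 ^ n"
      by (simp add: mult.commute flip: power_mult_distrib)
    then have "?f n = (- w) ^ n * Im (\<omega> ^ (n + 1)) * (3 ^ n * Gamma (real (n + 1) / 3) / fact n) / 3"
      using Im_\<omega>_mult_power[of 1 "-3 * w" n] by (simp del: power_Suc)
    then show ?thesis unfolding Gamma_triplication_nat by simp
  qed
  have "summable ?f"
    using airy_value_coeff_le by (rule summable_mult_cube_moments) simp
  then have f_sums: "?f sums suminf ?f" by (rule summable_sums)
  have t0: "?f (3 * k) = pi / 3 * (rGamma (real k + 2 / 3) / fact k * (w ^ 3) ^ k)" for k
    unfolding f unfolding real_3k rGamma_real_add_one Im_\<omega>_power
    by (simp add: power_mult power_mult_distrib[symmetric])
  have t1: "?f (3 * k + 1) = - (pi / 3) * w * (rGamma (real k + 4 / 3) / fact k * (w ^ 3) ^ k)" for k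
  proof -
    have e: "3 * k + 1 + 1 = 3 * k + 2" "3 * k + 1 + 2 = 3 * k + 3" "3 * k + 1 + 3 = 3 * k + 4" by auto
    show ?thesis
      unfolding f unfolding e unfolding real_3k rGamma_real_add_one Im_\<omega>_power
      by (simp add: power_mult power_mult_distrib[symmetric])
  qed
  have t2: "?f (3 * k + 2) = 0" for k
  proof -
    have e: "3 * k + 2 + 1 = 3 * (k + 1)" by auto
    show ?thesis unfolding f unfolding e unfolding Im_\<omega>_power by simp
  qed
  have "(\<lambda>k. pi / 3 * (rGamma (real k + 2 / 3) / fact k * (w ^ 3) ^ k) +
       (- (pi / 3) * w) * (rGamma (real k + 4 / 3) / fact k * (w ^ 3) ^ k)) sums suminf ?f"
    using sums_mod3[OF f_sums] unfolding t0 t1 t2 add_0_right .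
  moreover have "(\<lambda>k. pi / 3 * (rGamma (real k + 2 / 3) / fact k * (w ^ 3) ^ k) +
       (- (pi / 3) * w) * (rGamma (real k + 4 / 3) / fact k * (w ^ 3) ^ k)) sums
       (pi / 3 * clifford (2 / 3) (w ^ 3) + (- (pi / 3) * w) * clifford (4 / 3) (w ^ 3))"
    by (intro sums_add sums_mult clifford_sums)
  ultimately have "suminf ?f = pi / 3 * clifford (2 / 3) (w ^ 3) + (- (pi / 3) * w) * clifford (4 / 3) (w ^ 3)"
    by (rule sums_unique2)
  also have "\<dots> = airy_value w" by (simp add: airy_value_def algebra_simps)
  finally show ?thesis using f_sums by (simp only:)
qed

text \<open>The same splitting after discarding the vanishing term n = 0; now classes 0 and 2 of the
  shifted index survive.\<close>

lemma airy_slope_sums: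
  "(\<lambda>n. real n * Im (\<omega>\<^sup>2 * (of_real (-3 * w) * \<omega>) ^ (n - 1)) / fact n * (Gamma (real (n + 1) / 3) / 3))
     sums airy_slope w"
  (is "?g sums _")
proof -
  let ?f = "\<lambda>n. ?g (Suc n)"
  have f: "?f n = (- w) ^ n * Im (\<omega> ^ (n + 2)) *
      (2 * pi / (3 * sqrt 3) * (rGamma (real (n + 1) / 3) * rGamma (real (n + 3) / 3)))" for n
  proof -
    have w: "(-3 * w) ^ n = (- w) ^ n * 3 ^ n"
      by (simp add: mult.commute flip: power_mult_distrib)
    \<comment> \<open>Triplication at n + 1 has (n + 1)! below. Trading it for n! costs n + 1 = 3 z:
      the 3 enters the power, and z lowers the argument of \<open>rGamma (z + 1)\<close>.\<close>
    define z where "z = real (n + 1) / 3"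
    have "3 ^ n * Gamma (real (Suc n + 1) / 3) / fact n = z * (3 ^ Suc n * Gamma (real (Suc n + 1) / 3) / fact (Suc n))"
      by (simp add: z_def)
    also have "\<dots> = z * (2 * pi / sqrt 3 * (rGamma (real (Suc n + 2) / 3) * rGamma (real (Suc n + 3) / 3)))"
      unfolding Gamma_triplication_nat ..
    also have "real (Suc n + 2) / 3 = real (n + 3) / 3" by simp
    also have "real (Suc n + 3) / 3 = z + 1" by (simp add: z_def)
    also have "z * (2 * pi / sqrt 3 * (rGamma (real (n + 3) / 3) * rGamma (z + 1))) =
        2 * pi / sqrt 3 * ((z * rGamma (z + 1)) * rGamma (real (n + 3) / 3))" by simp
    finally have G: "3 ^ n * Gamma (real (Suc n + 1) / 3) / fact n =
       2 * pi / sqrt 3 * (rGamma (real (n + 1) / 3) * rGamma (real (n + 3) / 3))"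
      unfolding rGamma_plus1 z_def .
    have "?f n = (- w) ^ n * Im (\<omega> ^ (n + 2)) * (3 ^ n * Gamma (real (Suc n + 1) / 3) / fact n) / 3"
      using Im_\<omega>_mult_power[of 2 "-3 * w" n] w by (simp del: power_Suc)
    then show ?thesis unfolding G by simp
  qed
  have "summable ?g"
    using airy_slope_coeff_le by (rule summable_mult_cube_moments) simp
  then have g_sums: "?g sums suminf ?g" by (rule summable_sums)
  then have f_sums: "?f sums suminf ?g" by (subst sums_Suc_iff) simp
  have t0: "?f (3 * k) = pi / 3 * (rGamma (real k + 1 / 3) / fact k * (w ^ 3) ^ k)" for k
    unfolding f unfolding real_3k rGamma_real_add_one Im_\<omega>_power
    by (simp add: power_mult power_mult_distrib[symmetric])
  have t1: "?f (3 * k + 1) = 0" for k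
  proof -
    have e: "3 * k + 1 + 2 = 3 * (k + 1)" by auto
    show ?thesis unfolding f unfolding e unfolding Im_\<omega>_power by simp
  qed
  have t2: "?f (3 * k + 2) = - (pi / 3) * w\<^sup>2 * (rGamma (real k + 5 / 3) / fact k * (w ^ 3) ^ k)" for k
  proof -
    have e: "3 * k + 2 + 2 = 3 * (k + 1) + 1" "3 * k + 2 + 1 = 3 * k + 3" "3 * k + 2 + 3 = 3 * k + 5" by auto
    show ?thesis
      unfolding f unfolding e unfolding real_3k rGamma_real_add_one Im_\<omega>_power
      by (simp add: power_add power_mult power2_eq_square power_mult_distrib[symmetric])
  qed
  have "(\<lambda>k. pi / 3 * (rGamma (real k + 1 / 3) / fact k * (w ^ 3) ^ k) +
       (- (pi / 3) * w\<^sup>2) * (rGamma (real k + 5 / 3) / fact k * (w ^ 3) ^ k)) sums suminf ?g"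
    using sums_mod3[OF f_sums] unfolding t0 t1 t2 add_0_right .
  moreover have "(\<lambda>k. pi / 3 * (rGamma (real k + 1 / 3) / fact k * (w ^ 3) ^ k) +
       (- (pi / 3) * w\<^sup>2) * (rGamma (real k + 5 / 3) / fact k * (w ^ 3) ^ k)) sums
       (pi / 3 * clifford (1 / 3) (w ^ 3) + (- (pi / 3) * w\<^sup>2) * clifford (5 / 3) (w ^ 3))"
    by (intro sums_add sums_mult clifford_sums)
  ultimately have "suminf ?g = pi / 3 * clifford (1 / 3) (w ^ 3) + (- (pi / 3) * w\<^sup>2) * clifford (5 / 3) (w ^ 3)"
    by (rule sums_unique2)
  also have "\<dots> = airy_slope w" by (simp add: airy_slope_def algebra_simps)
  finally show ?thesis using g_sums by (simp only:)
qed

lemma airy_primitive_term: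
  "airy_primitive_coeff n * w ^ Suc n =
     Im ((of_real (-3 * w) * \<omega>) ^ Suc n) / fact (Suc n) * (Gamma (real (n + 1) / 3) / 3)"
proof -
  have "Im ((of_real (-3 * w) * \<omega>) ^ Suc n) = (-3 * w) ^ Suc n * Im (\<omega> ^ Suc n)"
    using Im_\<omega>_mult_power[of 0 "-3 * w" "Suc n"] by (simp del: power_Suc)
  moreover have "Im ((-3 * \<omega>) ^ Suc n) = (-3) ^ Suc n * Im (\<omega> ^ Suc n)"
    using Im_\<omega>_mult_power[of 0 "-3" "Suc n"] by (simp del: power_Suc)
  moreover have "(-3 * w) ^ Suc n = (-3) ^ Suc n * w ^ Suc n" by (rule power_mult_distrib)
  ultimately show ?thesis
    unfolding airy_primitive_coeff_def by (simp del: power_Suc fact_Suc)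
qed

lemma summable_airy_primitive: "summable (\<lambda>n. airy_primitive_coeff n * w ^ Suc n)"
  unfolding airy_primitive_term using airy_primitive_coeff_le by (rule summable_mult_cube_moments) simp

text \<open>Termwise, the factor n + 1 cancels against (n + 1)! and leaves -3 times the series of
  \<open>airy_value\<close>.\<close>

lemma airy_primitive_has_real_derivative:
  "(airy_primitive has_real_derivative -3 * airy_value w) (at w)"
proof -
  have derived: "airy_primitive_coeff n * real (Suc n) * w ^ n =
     -3 * (Im (\<omega> * (of_real (-3 * w) * \<omega>) ^ n) / fact n * (Gamma (real (n + 1) / 3) / 3))" for n w
  proof -
    have "Im (\<omega> * (of_real (-3 * w) * \<omega>) ^ n) = (-3 * w) ^ n * Im (\<omega> ^ Suc n)"
      using Im_\<omega>_mult_power[of 1 "-3 * w" n] by (simp del: power_Suc)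
    moreover have "Im ((-3 * \<omega>) ^ Suc n) = (-3) ^ Suc n * Im (\<omega> ^ Suc n)"
      using Im_\<omega>_mult_power[of 0 "-3" "Suc n"] by (simp del: power_Suc)
    moreover have "(-3 * w) ^ n = (-3) ^ n * w ^ n" by (rule power_mult_distrib)
    moreover have "real (Suc n) / fact (Suc n) = 1 / fact n" by simp
    ultimately show ?thesis
      unfolding airy_primitive_coeff_def by simp
  qed
  have "DERIV (\<lambda>w. \<Sum>n. airy_primitive_coeff n * w ^ Suc n) w :> (\<Sum>n. airy_primitive_coeff n * real (Suc n) * w ^ n)"
  proof (rule DERIV_power_series')
    show "summable (\<lambda>n. airy_primitive_coeff n * real (Suc n) * x ^ n)" for x
      unfolding derived using airy_value_sums by (intro summable_mult) (rule sums_summable)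
    show "w \<in> {- (\<bar>w\<bar> + 1)<..<\<bar>w\<bar> + 1}" by auto
  qed auto
  moreover have "(\<Sum>n. airy_primitive_coeff n * real (Suc n) * w ^ n) = -3 * airy_value w"
    unfolding derived using sums_mult[OF airy_value_sums] by (rule sums_unique[symmetric])
  ultimately show ?thesis unfolding airy_primitive_def[abs_def] by simp
qed

section \<open>Integral representations and decay\<close>

lemma Im_of_real_mult: "Im (of_real a * u) = a * Im u"
  by simp

text \<open>Series and integral are two readings of the same expansion; decay at infinity can be
  read off the integral.\<close>

lemma airy_value_integral:
  "has_bochner_integral (lebesgue_on {0<..})
     (\<lambda>t. Im (\<omega> * exp (of_real (-3 * w) * \<omega> * of_real t)) * exp (- (t ^ 3))) (airy_value w)"
  unfolding sums_unique[OF airy_value_sums]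
  by (rule has_bochner_integral_power_series(1)[OF has_bochner_integral_power_exp_cube _ _ _
        airy_value_coeff_le _ summable_cube_moments])
     (rule Im_exp_sums | simp)+

lemma airy_slope_integral:
  "has_bochner_integral (lebesgue_on {0<..})
     (\<lambda>t. t * Im (\<omega>\<^sup>2 * exp (of_real (-3 * w) * \<omega> * of_real t)) * exp (- (t ^ 3))) (airy_slope w)"
  unfolding sums_unique[OF airy_slope_sums]
  by (rule has_bochner_integral_power_series(1)[OF has_bochner_integral_power_exp_cube _ _ _
        airy_slope_coeff_le _ summable_cube_moments])
     (rule mult_Im_exp_sums | simp)+

lemma airy_primitive_integral:
  "has_bochner_integral (lebesgue_on {0<..})
     (\<lambda>t. Im (exp (of_real (-3 * w) * \<omega> * of_real t)) / t * exp (- (t ^ 3))) (airy_primitive w)"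
  unfolding airy_primitive_def airy_primitive_term
  by (rule has_bochner_integral_power_series(1)[OF has_bochner_integral_power_exp_cube _ _ _
        airy_primitive_coeff_le _ summable_cube_moments])
     (rule Im_exp_div_sums | simp)+

text \<open>
  Without the factor $e^{-t^3}$, expanding $e^{-3w\omega t}$ termwise diverges. Splitting off $e^{-6wt}$ first leaves
  $e^{zt}$ with $|z| < 6w$, so that the moments of $e^{-6wt}$ give convergent (geometric and logarithmic) series.
\<close>

context
  fixes w :: real
  assumes w: "w > 0"
begin

private abbreviation (input) "c \<equiv> 6 * w"
private abbreviation (input) "z \<equiv> of_real (6 * w) + of_real (-3 * w) * \<omega>"

private lemma norm_z_less: "norm z < c"
proof -
  \<comment> \<open>Explicitly, z = (3 w / 2) (3 - i sqrt 3).\<close>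
  have "(norm z)\<^sup>2 = 27 * w\<^sup>2"
    unfolding cmod_power2 by (simp add: cos_60 sin_60 power2_eq_square algebra_simps)
  also have "\<dots> < c\<^sup>2" using w by (simp add: power_mult_distrib)
  finally show ?thesis by (rule power_less_imp_less_base) (use w in simp)
qed

private lemma exp_z: "exp (z * of_real t) = of_real (exp (c * t)) * exp (of_real (-3 * w) * \<omega> * of_real t)"
  by (simp add: ring_distribs exp_add exp_of_real[symmetric] exp_diff exp_minus field_simps)

private lemma summable_exp_moments: "summable (\<lambda>n. norm z ^ n / fact n * (fact n / c ^ (n + 1)))"
proof -
  have "summable (\<lambda>n. (norm z / c) ^ n / c)"
    using norm_z_less w by (intro summable_divide summable_geometric) (auto simp: field_simps)
  then show ?thesis by (simp add: power_divide mult.commute)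
qed

text \<open>Including the factor \<open>\<omega>\<close>, the complex integral is 1 / (3 w), which
  is real.\<close>

lemma exp_ray_integral_value:
  "has_bochner_integral (lebesgue_on {0<..})
     (\<lambda>t. Im (\<omega> * exp (of_real (-3 * w) * \<omega> * of_real t))) 0"
proof -
  let ?a = "\<lambda>n. Im (\<omega> * z ^ n) / fact n"
  have "has_bochner_integral (lebesgue_on {0<..})
     (\<lambda>t. Im (\<omega> * exp (z * of_real t)) * exp (- c * t)) (\<Sum>n. ?a n * (fact n / c ^ (n + 1)))"
  proof (rule has_bochner_integral_power_series(1)[where C = 1 and r = "norm z"])
    show "has_bochner_integral (lebesgue_on {0<..}) (\<lambda>t. t ^ n * exp (- c * t)) (fact n / c ^ (n + 1))" for n
      using w by (intro has_bochner_integral_power_exp) auto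
    show "\<bar>?a n\<bar> \<le> 1 * (norm z ^ n / fact n)" for n
      using abs_Im_mult_power_le[of \<omega> z n] by (simp add: divide_right_mono)
    show "summable (\<lambda>n. norm z ^ n / fact n * (fact n / c ^ (n + 1)))" by (rule summable_exp_moments)
    show "(\<lambda>n. ?a n * t ^ n) sums Im (\<omega> * exp (z * of_real t))" for t by (rule Im_exp_sums)
  qed auto
  also have "(\<lambda>t. Im (\<omega> * exp (z * of_real t)) * exp (- c * t)) =
      (\<lambda>t. Im (\<omega> * exp (of_real (-3 * w) * \<omega> * of_real t)))"
  proof
    fix t
    have "\<omega> * exp (z * of_real t) = of_real (exp (c * t)) * (\<omega> * exp (of_real (-3 * w) * \<omega> * of_real t))"
      unfolding exp_z by (simp only: mult_ac)
    then have "Im (\<omega> * exp (z * of_real t)) = exp (c * t) * Im (\<omega> * exp (of_real (-3 * w) * \<omega> * of_real t))"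
      by (simp only: Im_of_real_mult)
    then show "Im (\<omega> * exp (z * of_real t)) * exp (- c * t) = Im (\<omega> * exp (of_real (-3 * w) * \<omega> * of_real t))"
      by (simp only: exp_minus) (simp add: exp_minus field_simps)
  qed
  also have "(\<Sum>n. ?a n * (fact n / c ^ (n + 1))) = 0"
  proof -
    \<comment> \<open>The moments cancel the factorials and leave a geometric series; as 1 - z / c
      is \<open>\<omega> / 2\<close>, its sum is 2 / c.\<close>
    have "norm (z / of_real c) < 1" using norm_z_less w by (simp add: norm_divide)
    from sums_Im[OF sums_mult[OF geometric_sums[OF this], of "\<omega> / of_real c"]]
    have "(\<lambda>n. Im (\<omega> / of_real c * (z / of_real c) ^ n)) sums Im (\<omega> / of_real c * (1 / (1 - z / of_real c)))" .
    also have "\<omega> / of_real c * (1 / (1 - z / of_real c)) = of_real (1 / (3 * w))"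
    proof -
      have "1 - z / of_real c = \<omega> / 2" using w by (simp add: field_simps)
      then show ?thesis using w by (simp only:) simp
    qed
    also have "(\<lambda>n. Im (\<omega> / of_real c * (z / of_real c) ^ n)) = (\<lambda>n. ?a n * (fact n / c ^ (n + 1)))"
    proof
      fix n
      have "\<omega> / of_real c * (z / of_real c) ^ n = of_real (1 / c ^ (n + 1)) * (\<omega> * z ^ n)"
        by (simp add: power_divide)
      then have "Im (\<omega> / of_real c * (z / of_real c) ^ n) = 1 / c ^ (n + 1) * Im (\<omega> * z ^ n)"
        by (simp only: Im_of_real_mult)
      then show "Im (\<omega> / of_real c * (z / of_real c) ^ n) = ?a n * (fact n / c ^ (n + 1))"
        by (simp only:) simp
    qed
    finally show ?thesis by (simp only: Im_complex_of_real sums_iff)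
  qed
  finally show ?thesis .
qed

text \<open>Dividing by t turns the geometric series into that of -Ln (1 - z / c) = -Ln
  (\<open>\<omega> / 2\<close>), whose imaginary part is -pi/3 for every w.\<close>

lemma exp_ray_integral_primitive:
  "has_bochner_integral (lebesgue_on {0<..})
     (\<lambda>t. Im (exp (of_real (-3 * w) * \<omega> * of_real t)) / t) (- (pi / 3))"
proof -
  let ?a = "\<lambda>n. Im (z ^ Suc n) / fact (Suc n)"
  have "has_bochner_integral (lebesgue_on {0<..})
     (\<lambda>t. Im (exp (z * of_real t)) / t * exp (- c * t)) (\<Sum>n. ?a n * (fact n / c ^ (n + 1)))"
  proof (rule has_bochner_integral_power_series(1)[where C = "norm z" and r = "norm z"])
    show "has_bochner_integral (lebesgue_on {0<..}) (\<lambda>t. t ^ n * exp (- c * t)) (fact n / c ^ (n + 1))" for n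
      using w by (intro has_bochner_integral_power_exp) auto
    show "\<bar>?a n\<bar> \<le> norm z * (norm z ^ n / fact n)" for n
    proof -
      have "\<bar>Im (z ^ Suc n)\<bar> / fact (Suc n) \<le> norm z ^ Suc n / fact n"
        using abs_Im_mult_power_le[of 1 z "Suc n"] by (intro frac_le fact_mono) (auto simp del: fact_Suc power_Suc)
      then show ?thesis by (simp del: fact_Suc add: abs_divide)
    qed
    show "summable (\<lambda>n. norm z ^ n / fact n * (fact n / c ^ (n + 1)))" by (rule summable_exp_moments)
    show "(\<lambda>n. ?a n * t ^ n) sums (Im (exp (z * of_real t)) / t)" if "t \<in> space (lebesgue_on {0<..})" for t
      using that by (intro Im_exp_div_sums) auto
  qed auto
  also have "(\<lambda>t. Im (exp (z * of_real t)) / t * exp (- c * t)) =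
      (\<lambda>t. Im (exp (of_real (-3 * w) * \<omega> * of_real t)) / t)"
  proof -
    have "exp (c * t) * u / t * exp (- c * t) = u / t" for u t :: real
      by (simp add: exp_minus)
    then show ?thesis unfolding exp_z Im_of_real_mult by (simp only:)
  qed
  also have "(\<Sum>n. ?a n * (fact n / c ^ (n + 1))) = - (pi / 3)"
  proof -
    have "norm (- (z / of_real c)) < 1" using norm_z_less w by (simp add: norm_divide)
    from Ln_series'[OF this]
    have "(\<lambda>n. - ((z / of_real c) ^ n) / of_nat n) sums Ln (1 - z / of_real c)" by simp
    \<comment> \<open>The term at index 0 is a division by zero, hence 0, so the series may start at
      1.\<close>
    then have "(\<lambda>n. - ((z / of_real c) ^ Suc n) / of_nat (Suc n)) sums Ln (1 - z / of_real c)"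
      by (subst sums_Suc_iff) simp
    from sums_minus[OF sums_Im[OF this]]
    have "(\<lambda>n. - Im (- ((z / of_real c) ^ Suc n) / of_nat (Suc n))) sums - Im (Ln (1 - z / of_real c))" .
    also have "(\<lambda>n. - Im (- ((z / of_real c) ^ Suc n) / of_nat (Suc n))) = (\<lambda>n. ?a n * (fact n / c ^ (n + 1)))"
    proof
      fix n
      have "(z / of_real c) ^ Suc n / of_nat (Suc n) = of_real (1 / (c ^ (n + 1) * real (Suc n))) * z ^ Suc n"
        by (simp add: power_divide del: of_nat_Suc)
      then have "Im ((z / of_real c) ^ Suc n / of_nat (Suc n)) = 1 / (c ^ (n + 1) * real (Suc n)) * Im (z ^ Suc n)"
        by (simp only: Im_of_real_mult)
      also have "\<dots> = ?a n * (fact n / c ^ (n + 1))"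
        by (simp del: power_Suc of_nat_Suc)
      finally show "- Im (- ((z / of_real c) ^ Suc n) / of_nat (Suc n)) = ?a n * (fact n / c ^ (n + 1))"
        by (simp only: divide_minus_left uminus_complex.sel minus_minus)
    qed
    \<comment> \<open>The exponent has imaginary part pi/3, inside the principal strip, so
      \<open>Ln\<close> returns it.\<close>
    also have "1 - z / of_real c = exp (Complex (- ln 2) (pi / 3))"
    proof -
      have "1 - z / of_real c = \<omega> / 2" using w by (simp add: field_simps)
      then show ?thesis by (simp add: exp_eq_polar exp_minus exp_of_real)
    qed
    also have "Ln (exp (Complex (- ln 2) (pi / 3))) = Complex (- ln 2) (pi / 3)"
      by (rule Ln_exp) (use pi_gt_zero in \<open>simp_all\<close>)
    finally show ?thesis by (simp only: complex.sel sums_iff)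
  qed
  finally show ?thesis .
qed

end

section \<open>Decay as w tends to infinity\<close>

lemma norm_exp_ray: "norm (exp (of_real (-3 * w) * \<omega> * of_real t)) = exp (- (3 * w / 2) * t)"
  by (simp add: norm_exp_eq_Re cos_60)

lemma one_minus_exp_cube_le:
  assumes "t > (0 :: real)"
  shows "\<bar>exp (- (t ^ 3)) - 1\<bar> \<le> t ^ 3"
  using exp_ge_add_one_self[of "- (t ^ 3)"] assms by simp

text \<open>The real part of \<open>\<omega>\<close> is 1/2, so the exponential decays at rate 3 w /
  2; bounding exp (-t^3) by 1 leaves a first moment.\<close>

lemma abs_airy_slope_le:
  assumes "w > 0"
  shows "\<bar>airy_slope w\<bar> \<le> 4 / 9 / w\<^sup>2"
proof -
  have "\<bar>airy_slope w\<bar> \<le> fact 1 / (3 * w / 2) ^ (1 + 1)"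
  proof (rule abs_has_bochner_integral_le[OF airy_slope_integral])
    fix t :: real assume t: "t > 0"
    let ?e = "exp (of_real (-3 * w) * \<omega> * of_real t)"
    have "\<bar>Im (\<omega>\<^sup>2 * ?e)\<bar> \<le> exp (- (3 * w / 2) * t)"
      using abs_Im_le_cmod[of "\<omega>\<^sup>2 * ?e"] unfolding norm_mult norm_exp_ray by (simp add: norm_power)
    then have "\<bar>t * Im (\<omega>\<^sup>2 * ?e) * exp (- (t ^ 3))\<bar> \<le> t * exp (- (3 * w / 2) * t) * 1"
      unfolding abs_mult using t by (intro mult_mono) auto
    then show "\<bar>t * Im (\<omega>\<^sup>2 * ?e) * exp (- (t ^ 3))\<bar> \<le> t ^ 1 * exp (- (3 * w / 2) * t)"
      by (simp only: power_one_right mult_1_right)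
  qed (use assms in simp)
  also have "\<dots> = 4 / 9 / w\<^sup>2" by (simp add: power2_eq_square)
  finally show ?thesis .
qed

text \<open>Subtracting the vanishing ray integral replaces exp (-t^3) by a factor of size at most
  t^3, which gains three powers of w. A bound of order 1 / w would yield only 1 / x for the Bessel
  function, which is not integrable at infinity.\<close>

lemma abs_airy_value_le:
  assumes "w > 0"
  shows "\<bar>airy_value w\<bar> \<le> 32 / 27 / w ^ 4"
proof -
  let ?e = "\<lambda>t. exp (of_real (-3 * w) * \<omega> * of_real t)"
  have "has_bochner_integral (lebesgue_on {0<..})
     (\<lambda>t. Im (\<omega> * ?e t) * exp (- (t ^ 3)) - Im (\<omega> * ?e t)) (airy_value w - 0)"
    by (intro has_bochner_integral_diff airy_value_integral exp_ray_integral_value assms)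
  then have "\<bar>airy_value w - 0\<bar> \<le> fact 3 / (3 * w / 2) ^ (3 + 1)"
  proof (rule abs_has_bochner_integral_le)
    fix t :: real assume t: "t > 0"
    have "\<bar>Im (\<omega> * ?e t)\<bar> \<le> exp (- (3 * w / 2) * t)"
      using abs_Im_le_cmod[of "\<omega> * ?e t"] unfolding norm_mult norm_exp_ray by simp
    then have "\<bar>exp (- (t ^ 3)) - 1\<bar> * \<bar>Im (\<omega> * ?e t)\<bar> \<le> t ^ 3 * exp (- (3 * w / 2) * t)"
      using t one_minus_exp_cube_le[OF t] by (intro mult_mono) auto
    also have "\<bar>exp (- (t ^ 3)) - 1\<bar> * \<bar>Im (\<omega> * ?e t)\<bar> = \<bar>Im (\<omega> * ?e t) * exp (- (t ^ 3)) - Im (\<omega> * ?e t)\<bar>"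
      unfolding abs_mult[symmetric] by (simp only: left_diff_distrib mult_1_left mult.commute)
    finally show "\<bar>Im (\<omega> * ?e t) * exp (- (t ^ 3)) - Im (\<omega> * ?e t)\<bar> \<le> t ^ 3 * exp (- (3 * w / 2) * t)" .
  qed (use assms in simp)
  also have "\<dots> = 32 / 27 / w ^ 4" by (simp add: power_divide power_mult_distrib fact_numeral)
  finally show ?thesis by simp
qed

text \<open>The same subtraction, now of a ray integral equal to -pi/3; dividing by t lowers t^3 to
  t^2.\<close>

lemma abs_airy_primitive_plus_le:
  assumes "w > 0"
  shows "\<bar>airy_primitive w + pi / 3\<bar> \<le> 16 / 27 / w ^ 3"
proof -
  let ?e = "\<lambda>t. exp (of_real (-3 * w) * \<omega> * of_real t)"
  have "has_bochner_integral (lebesgue_on {0<..})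
     (\<lambda>t. Im (?e t) / t * exp (- (t ^ 3)) - Im (?e t) / t) (airy_primitive w - - (pi / 3))"
    by (intro has_bochner_integral_diff airy_primitive_integral exp_ray_integral_primitive assms)
  then have "\<bar>airy_primitive w - - (pi / 3)\<bar> \<le> fact 2 / (3 * w / 2) ^ (2 + 1)"
  proof (rule abs_has_bochner_integral_le)
    fix t :: real assume t: "t > 0"
    have "\<bar>Im (?e t)\<bar> \<le> exp (- (3 * w / 2) * t)"
      using abs_Im_le_cmod[of "?e t"] unfolding norm_exp_ray .
    then have "\<bar>exp (- (t ^ 3)) - 1\<bar> * \<bar>Im (?e t)\<bar> / t \<le> t ^ 3 * exp (- (3 * w / 2) * t) / t"
      using t one_minus_exp_cube_le[OF t] by (intro divide_right_mono mult_mono) auto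
    also have "t ^ 3 * exp (- (3 * w / 2) * t) / t = t\<^sup>2 * exp (- (3 * w / 2) * t)"
      using t by (simp add: power2_eq_square power3_eq_cube)
    also have "\<bar>exp (- (t ^ 3)) - 1\<bar> * \<bar>Im (?e t)\<bar> / t = \<bar>(exp (- (t ^ 3)) - 1) * Im (?e t) / t\<bar>"
      unfolding abs_mult abs_divide using t by (simp only: abs_of_pos)
    also have "(exp (- (t ^ 3)) - 1) * Im (?e t) / t = Im (?e t) / t * exp (- (t ^ 3)) - Im (?e t) / t"
      by (simp only: left_diff_distrib diff_divide_distrib mult_1_left times_divide_eq_left mult.commute[of "exp _"])
    finally show "\<bar>Im (?e t) / t * exp (- (t ^ 3)) - Im (?e t) / t\<bar> \<le> t\<^sup>2 * exp (- (3 * w / 2) * t)" .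
  qed (use assms in simp)
  also have "\<dots> = 16 / 27 / w ^ 3" by (simp add: power_divide power_mult_distrib)
  finally show ?thesis by simp
qed

section \<open>The integral of the Bessel function\<close>

text \<open>Truncating f to [a, a + k] gives functions dominated by h whose integrals are F (a + k)
  - F a; dominated convergence yields both integrability and the value.\<close>

lemma has_integral_FTC_at_top:
  fixes f F h :: "real \<Rightarrow> real"
  assumes deriv: "\<And>x. x \<ge> a \<Longrightarrow> (F has_real_derivative f x) (at x)"
    and h: "h integrable_on {a..}" "\<And>x. x \<ge> a \<Longrightarrow> \<bar>f x\<bar> \<le> h x"
    and lim: "(F \<longlongrightarrow> L) at_top"
  shows "(f has_integral (L - F a)) {a..}"
proof -
  define g where "g k x = (if x \<in> {a..a + real k} then f x else 0)" for k x
  have g: "(g k has_integral (F (a + real k) - F a)) {a..}" for k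
  proof -
    have "(f has_integral (F (a + real k) - F a)) {a..a + real k}"
      using deriv by (intro fundamental_theorem_of_calculus)
        (auto simp: has_real_derivative_iff_has_vector_derivative intro: has_vector_derivative_at_within)
    then show ?thesis
      unfolding g_def[abs_def] by (subst has_integral_restrict) auto
  qed
  have "f integrable_on {a..}" and "(\<lambda>k. integral {a..} (g k)) \<longlonglongrightarrow> integral {a..} f"
  proof -
    have "(\<lambda>k. g k x) \<longlonglongrightarrow> f x" if "x \<in> {a..}" for x
    proof (rule tendsto_eventually)
      obtain N where "x - a \<le> real N" using real_arch_simple by blast
      then show "\<forall>\<^sub>F k in sequentially. g k x = f x"
        using that by (intro eventually_sequentiallyI[of N]) (auto simp: g_def)
    qed
    moreover have "norm (g k x) \<le> h x" if "x \<in> {a..}" for k x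
      using h(2)[of x] that by (auto simp: g_def intro: order_trans[OF abs_ge_zero])
    moreover have "g k integrable_on {a..}" for k
      using g by (rule has_integral_integrable)
    ultimately show "f integrable_on {a..}" "(\<lambda>k. integral {a..} (g k)) \<longlonglongrightarrow> integral {a..} f"
      using dominated_convergence[of g "{a..}" h f] h(1) by blast+
  qed
  moreover have "(\<lambda>k. integral {a..} (g k)) \<longlonglongrightarrow> L - F a"
  proof -
    have "filterlim (\<lambda>k. a + real k) at_top sequentially"
      by (intro filterlim_tendsto_add_at_top[OF tendsto_const] filterlim_real_sequentially)
    then have "(\<lambda>k. F (a + real k) - F a) \<longlonglongrightarrow> L - F a"
      by (intro tendsto_intros filterlim_compose[OF lim])
    then show ?thesis unfolding integral_unique[OF g] .
  qed
  ultimately have "integral {a..} f = L - F a" by (intro LIMSEQ_unique)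
  with \<open>f integrable_on {a..}\<close> show ?thesis by (simp add: has_integral_iff)
qed

text \<open>This is Airy's equation in the rescaled variable; the recurrence at 2/3 identifies the
  derivative with the series in \<open>airy_value\<close>.\<close>

lemma airy_slope_has_real_derivative:
  "(airy_slope has_real_derivative -3 * w * airy_value w) (at w)"
proof -
  have "(airy_slope has_real_derivative
      pi / 3 * (clifford (4 / 3) (w ^ 3) * (3 * w\<^sup>2) -
        (2 * w * clifford (5 / 3) (w ^ 3) + w\<^sup>2 * (clifford (8 / 3) (w ^ 3) * (3 * w\<^sup>2))))) (at w)"
    unfolding airy_slope_def[abs_def] by (auto intro!: derivative_eq_intros)
  also have "clifford (2 / 3) (w ^ 3) = 2 / 3 * clifford (5 / 3) (w ^ 3) + w ^ 3 * clifford (8 / 3) (w ^ 3)"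
    using clifford_recurrence[of "2 / 3" "w ^ 3"] by simp
  then have "pi / 3 * (clifford (4 / 3) (w ^ 3) * (3 * w\<^sup>2) -
        (2 * w * clifford (5 / 3) (w ^ 3) + w\<^sup>2 * (clifford (8 / 3) (w ^ 3) * (3 * w\<^sup>2)))) =
      -3 * w * airy_value w"
    unfolding airy_value_def by (simp only:) (simp add: field_simps power2_eq_square power3_eq_cube)
  finally show ?thesis .
qed

text \<open>Comes from K_{5/3} = -2 K_{2/3}' - K_{1/3}, where K_{2/3} is sqrt 3 B / w and K_{1/3} dx
  is 3 sqrt 3 A dw.\<close>

definition bessel_K_primitive :: "real \<Rightarrow> real" where
  "bessel_K_primitive w = sqrt 3 * (airy_primitive w - 2 * airy_slope w / w)"

text \<open>With the cube root as the variable, all fractional powers become integer powers and the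
  identities below become rational.\<close>

lemma powr_thirds:
  assumes "y > (0 :: real)"
  shows "y powr (2 / 3) = (y powr (1 / 3))\<^sup>2" "(y powr (1 / 3)) ^ 3 = y"
    "y powr (5 / 3) = (y powr (1 / 3)) ^ 5" "y powr (- (5 / 3)) = 1 / (y powr (1 / 3)) ^ 5"
    "y powr (- 1 / 3) = 1 / y powr (1 / 3)"
proof -
  have n: "(y powr (1 / 3)) ^ n = y powr (real n / 3)" for n
  proof -
    have "(y powr (1 / 3)) ^ n = (y powr (1 / 3)) powr real n"
      using assms by (simp add: powr_realpow)
    then show ?thesis by (simp add: powr_powr)
  qed
  show "y powr (2 / 3) = (y powr (1 / 3))\<^sup>2" "(y powr (1 / 3)) ^ 3 = y"
    "y powr (5 / 3) = (y powr (1 / 3)) ^ 5" "y powr (- (5 / 3)) = 1 / (y powr (1 / 3)) ^ 5"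
    "y powr (- 1 / 3) = 1 / y powr (1 / 3)"
    unfolding n using assms by (simp_all add: powr_minus_divide)
qed

text \<open>This is K_{5/3} = K_{1/3} + 4 / (3 x) K_{2/3}. The last factor is dw/dx, which prepares
  the chain rule.\<close>

lemma bessel_K_five_thirds:
  assumes "x > 0"
  defines "w \<equiv> (x / 2) powr (2 / 3)"
  shows "bessel_K (5 / 3) x =
    sqrt 3 * (3 * airy_value w + 2 * airy_slope w / w\<^sup>2) * ((x / 2) powr (-1 / 3) / 3)"
proof -
  define s where "s = (x / 2) powr (1 / 3)"
  have s: "s > 0" using assms by (simp add: s_def)
  have "x / 2 > 0" using assms by simp
  note p = powr_thirds[OF this, folded s_def]
  have w: "w = s\<^sup>2" by (simp only: w_def p)
  have w3: "(x / 2)\<^sup>2 = w ^ 3"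
    unfolding w p(2)[symmetric] by (simp flip: power_mult)
  have sin: "sin (5 / 3 * pi) = - (sqrt 3 / 2)"
  proof -
    have "sin (5 / 3 * pi) = sin (- (pi / 3) + 2 * pi)" by (rule arg_cong[where f = sin]) simp
    then show ?thesis by (simp only: sin_periodic sin_minus sin_60)
  qed
  define A B C where "A = clifford (1 / 3) (w ^ 3)" and "B = clifford (4 / 3) (w ^ 3)" and "C = clifford (5 / 3) (w ^ 3)"
  define D where "D = clifford (8 / 3) (w ^ 3)"
  \<comment> \<open>The recurrence lifts the parameter -2/3 of I_{-5/3} to 1/3 and 4/3, and splits
    2/3 into 5/3 and the 8/3 of I_{5/3}. The 5/3 parts of \<open>airy_value\<close> and
    \<open>airy_slope\<close> then cancel.\<close>
  have c: "clifford (2 / 3) (w ^ 3) = 2 / 3 * C + w ^ 3 * D"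
          "clifford (- (5 / 3) + 1) (w ^ 3) = - 2 / 3 * A + w ^ 3 * B"
    using clifford_recurrence[of "2 / 3" "w ^ 3"] clifford_recurrence[of "- (5 / 3) + 1" "w ^ 3"]
    by (simp_all add: A_def B_def C_def D_def)
  have "bessel_K (5 / 3) x = pi / 2 * ((1 / s ^ 5 * (- 2 / 3 * A + w ^ 3 * B) - s ^ 5 * D) / (- (sqrt 3 / 2)))"
    unfolding bessel_K_def bessel_I_eq_clifford[OF assms(1)] sin p w3 c D_def by simp
  also have "pi / 2 * (X / (- (sqrt 3 / 2))) = - (sqrt 3 * (pi / 3) * X)" for X
  proof -
    have "sqrt 3 * (sqrt 3 * y) = 3 * y" for y :: real by (simp flip: mult.assoc)
    then show ?thesis by (simp add: field_simps)
  qed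
  also have "- (sqrt 3 * (pi / 3) * (1 / s ^ 5 * (- 2 / 3 * A + w ^ 3 * B) - s ^ 5 * D)) =
      sqrt 3 * (pi / 3) * (1 / s ^ 5 * (2 / 3 * A - w ^ 3 * B) + s ^ 5 * D)"
    by (simp add: algebra_simps)
  also have "\<dots> = sqrt 3 * (3 * airy_value w + 2 * airy_slope w / w\<^sup>2) * ((x / 2) powr (-1 / 3) / 3)"
    unfolding airy_value_def airy_slope_def p c
    unfolding A_def[symmetric] B_def[symmetric] C_def[symmetric]
    unfolding w using s by (simp add: divide_simps) (simp add: algebra_simps eval_nat_numeral)
  finally show ?thesis .
qed

lemma bessel_K_primitive_has_real_derivative:
  assumes "x > 0"
  shows "((\<lambda>x. bessel_K_primitive ((x / 2) powr (2 / 3))) has_real_derivative bessel_K (5 / 3) x) (at x)"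
proof -
  define w where "w = (x / 2) powr (2 / 3)"
  have w: "w > 0" using assms by (simp add: w_def)
  have "(bessel_K_primitive has_real_derivative
      sqrt 3 * (-3 * airy_value w - (2 * (-3 * w * airy_value w) * w - 2 * airy_slope w * 1) / (w * w))) (at w)"
    unfolding bessel_K_primitive_def[abs_def] using w
    by (auto intro!: derivative_eq_intros airy_slope_has_real_derivative airy_primitive_has_real_derivative)
  also have "sqrt 3 * (-3 * airy_value w - (2 * (-3 * w * airy_value w) * w - 2 * airy_slope w * 1) / (w * w)) =
      sqrt 3 * (3 * airy_value w + 2 * airy_slope w / w\<^sup>2)"
    using w by (simp add: field_simps power2_eq_square)
  finally have Q: "(bessel_K_primitive has_real_derivative sqrt 3 * (3 * airy_value w + 2 * airy_slope w / w\<^sup>2))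
      (at ((x / 2) powr (2 / 3)))" unfolding w_def .
  have "((\<lambda>x. (x / 2) powr (2 / 3)) has_real_derivative ((x / 2) powr (-1 / 3) / 3)) (at x)"
    using assms by (auto intro!: derivative_eq_intros)
  from DERIV_chain2[OF Q this] show ?thesis
    unfolding bessel_K_five_thirds[OF assms] w_def .
qed

text \<open>Both summands are of order w^(-4), and with the prefactor (x/2)^(-1/3) this gives the
  power -3 of x, an integrable majorant.\<close>

lemma abs_bessel_K_five_thirds_le:
  assumes "x > 0"
  shows "\<bar>bessel_K (5 / 3) x\<bar> \<le> sqrt 3 * (320 / 27) * (1 / x ^ 3)"
proof -
  define s where "s = (x / 2) powr (1 / 3)"
  have s: "s > 0" using assms by (simp add: s_def)
  have "x / 2 > 0" using assms by simp
  note p = powr_thirds[OF this, folded s_def]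
  define w where "w = (x / 2) powr (2 / 3)"
  have w: "w > 0" using assms by (simp add: w_def)
  have "\<bar>3 * airy_value w + 2 * airy_slope w / w\<^sup>2\<bar> \<le> 3 * \<bar>airy_value w\<bar> + 2 * \<bar>airy_slope w\<bar> / w\<^sup>2"
    by (rule order_trans[OF abs_triangle_ineq]) (simp add: abs_mult)
  also have "\<dots> \<le> 3 * (32 / 27 / w ^ 4) + 2 * (4 / 9 / w\<^sup>2) / w\<^sup>2"
    by (intro add_mono mult_left_mono divide_right_mono abs_airy_value_le[OF w] abs_airy_slope_le[OF w]) auto
  also have "\<dots> = 40 / 9 / w ^ 4" by (simp add: eval_nat_numeral)
  finally have "\<bar>bessel_K (5 / 3) x\<bar> \<le> sqrt 3 * (40 / 9 / w ^ 4) * ((x / 2) powr (-1 / 3) / 3)"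
    unfolding bessel_K_five_thirds[OF assms] w_def[symmetric] abs_mult
    using w by (intro mult_mono) auto
  also have "\<dots> = sqrt 3 * (40 / 27) / s ^ 9"
    unfolding w_def p by (simp flip: power_mult power_Suc2)
  also have "s ^ 9 = (s ^ 3) ^ 3" by (simp flip: power_mult)
  also have "\<dots> = x ^ 3 / 8" unfolding p by (simp add: power_divide)
  finally show ?thesis by simp
qed

lemma bessel_K_primitive_at_top: "(bessel_K_primitive \<longlongrightarrow> - (pi / sqrt 3)) at_top"
proof -
  have "((\<lambda>w. airy_primitive w + pi / 3) \<longlongrightarrow> 0) at_top"
  proof (rule Lim_null_comparison)
    show "\<forall>\<^sub>F w in at_top. norm (airy_primitive w + pi / 3) \<le> 16 / 27 / w ^ 3"
      using eventually_gt_at_top[of 0] by eventually_elim (simp only: real_norm_def abs_airy_primitive_plus_le)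
    show "((\<lambda>w::real. 16 / 27 / w ^ 3) \<longlongrightarrow> 0) at_top" by real_asymp
  qed
  moreover have "((\<lambda>w. 2 * airy_slope w / w) \<longlongrightarrow> 0) at_top"
  proof (rule Lim_null_comparison)
    show "\<forall>\<^sub>F w in at_top. norm (2 * airy_slope w / w) \<le> 2 * (4 / 9 / w\<^sup>2) / w"
      using eventually_gt_at_top[of 0]
    proof eventually_elim
      case (elim w)
      then have "2 * \<bar>airy_slope w\<bar> / w \<le> 2 * (4 / 9 / w\<^sup>2) / w"
        by (intro divide_right_mono mult_left_mono abs_airy_slope_le) auto
      with elim show ?case by (simp add: abs_mult)
    qed
    show "((\<lambda>w::real. 2 * (4 / 9 / w\<^sup>2) / w) \<longlongrightarrow> 0) at_top" by real_asymp
  qed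
  ultimately have "((\<lambda>w. sqrt 3 * ((airy_primitive w + pi / 3) - pi / 3 - 2 * airy_slope w / w)) \<longlongrightarrow> sqrt 3 * (0 - pi / 3 - 0)) at_top"
    by (intro tendsto_intros)
  moreover have "sqrt 3 * (0 - pi / 3 - 0) = - (pi / sqrt 3)" by (simp add: field_simps)
  ultimately show ?thesis unfolding bessel_K_primitive_def[abs_def] by simp
qed

lemma integral_bessel_K_five_thirds:
  assumes "x > 0"
  shows "integral {x..} (bessel_K (5 / 3)) = - (pi / sqrt 3) - bessel_K_primitive ((x / 2) powr (2 / 3))"
proof (rule integral_unique, rule has_integral_FTC_at_top)
  show "((\<lambda>x. bessel_K_primitive ((x / 2) powr (2 / 3))) has_real_derivative bessel_K (5 / 3) y) (at y)" if "y \<ge> x" for y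
    using assms that by (intro bessel_K_primitive_has_real_derivative) auto
  show "\<bar>bessel_K (5 / 3) y\<bar> \<le> sqrt 3 * (320 / 27) * (1 / y ^ 3)" if "y \<ge> x" for y
    using assms that by (intro abs_bessel_K_five_thirds_le) auto
  have "(\<lambda>y. 1 / y ^ 3) integrable_on {x..}"
    using has_integral_inverse_power_to_inf[of 3 x] assms by (auto simp: integrable_on_def)
  then show "(\<lambda>y. sqrt 3 * (320 / 27) * (1 / y ^ 3)) integrable_on {x..}"
    by (intro integrable_on_mult_right)
  have "filterlim (\<lambda>x::real. (x / 2) powr (2 / 3)) at_top at_top" by real_asymp
  then show "((\<lambda>x. bessel_K_primitive ((x / 2) powr (2 / 3))) \<longlongrightarrow> - (pi / sqrt 3)) at_top"
    by (rule filterlim_compose[OF bessel_K_primitive_at_top])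
qed

section \<open>Expansion at the origin\<close>

text \<open>The terms linear in w from the Airy slope and from the primitive cancel, their terms in
  w^2 combine to the coefficient 3/4, and neither has a term in w^3.\<close>

lemma bessel_K_primitive_expansion:
  "(\<lambda>w. - bessel_K_primitive w - (Gamma (2 / 3) / w + 3 / 4 * Gamma (2 / 3) * w\<^sup>2)) \<in> O[at_right 0](\<lambda>w. w ^ 4)"
proof -
  define G :: real where "G = Gamma (2 / 3)"
  have G: "G > 0" unfolding G_def by (intro Gamma_real_pos) simp
  have G1: "Gamma (1 / 3) = 2 * pi / (sqrt 3 * G)"
    using Gamma_one_third_two_thirds[folded G_def] G by (simp add: field_simps)
  have r: "rGamma (1 / 3) = sqrt 3 * G / (2 * pi)" "rGamma (4 / 3) = 3 * sqrt 3 * G / (2 * pi)"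
    "rGamma (5 / 3) = 3 / (2 * G)"
    unfolding rGamma_inverse_Gamma Gamma_four_thirds Gamma_five_thirds G1 G_def[symmetric] by simp_all
  have b: "airy_primitive_coeff 0 = - pi / G" "airy_primitive_coeff 1 = 3 * sqrt 3 / 4 * G" "airy_primitive_coeff 2 = 0"
  proof -
    have "airy_primitive_coeff n = (-3) ^ Suc n * Im (\<omega> ^ Suc n) / fact (Suc n) * (Gamma (real (n + 1) / 3) / 3)" for n
    proof -
      have "Im ((-3 * \<omega>) ^ Suc n) = (-3) ^ Suc n * Im (\<omega> ^ Suc n)"
        using Im_\<omega>_mult_power[of 0 "-3" "Suc n"] by (simp del: power_Suc)
      then show ?thesis by (simp only: airy_primitive_coeff_def)
    qed
    note * = this[of 0] this[of 1] this[of 2]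
    have i: "Suc 0 = 3 * 0 + 1" "Suc 1 = 3 * 0 + 2" "Suc 2 = 3 * 1" by auto
    have im: "Im (\<omega> ^ Suc 0) = sqrt 3 / 2" "Im (\<omega> ^ Suc 1) = sqrt 3 / 2" "Im (\<omega> ^ Suc 2) = 0"
      unfolding i Im_\<omega>_power by simp_all
    show "airy_primitive_coeff 0 = - pi / G" "airy_primitive_coeff 1 = 3 * sqrt 3 / 4 * G" "airy_primitive_coeff 2 = 0"
      unfolding * im using G by (simp_all add: G1 G_def[symmetric])
  qed
  \<comment> \<open>The three remainders are cut so that, after the factors 1 / w, w and w, they are
    of order w^5, w^4 and w^4.\<close>
  define e1 where "e1 y = clifford (1 / 3) y - (rGamma (1 / 3) + rGamma (4 / 3) * y)" for y
  define e5 where "e5 y = clifford (5 / 3) y - rGamma (5 / 3)" for y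
  define S where "S w = (\<Sum>n. airy_primitive_coeff n * w ^ n)" for w
  define eS where "eS w = S w - (airy_primitive_coeff 0 + airy_primitive_coeff 1 * w)" for w
  have "e1 \<in> O[at 0](\<lambda>y. y ^ 2)"
    using powser_minus_partial_sum_bigo[OF summable_clifford[of "1 / 3"], of 2]
    unfolding clifford_def[symmetric] e1_def[abs_def] by (simp add: lessThan_Suc eval_nat_numeral algebra_simps)
  moreover have "filterlim (\<lambda>w. w ^ 3) (at (0 :: real)) (at_right 0)" by real_asymp
  ultimately have e1: "(\<lambda>w. e1 (w ^ 3)) \<in> O[at_right 0](\<lambda>w. (w ^ 3) ^ 2)"
    by (rule landau_o.big.compose)
  have "e5 \<in> O[at 0](\<lambda>y. y ^ 1)"
    using powser_minus_partial_sum_bigo[OF summable_clifford[of "5 / 3"], of 1]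
    unfolding clifford_def[symmetric] e5_def[abs_def] by (simp add: lessThan_Suc)
  moreover have "filterlim (\<lambda>w. w ^ 3) (at (0 :: real)) (at_right 0)" by real_asymp
  ultimately have e5: "(\<lambda>w. e5 (w ^ 3)) \<in> O[at_right 0](\<lambda>w. (w ^ 3) ^ 1)"
    by (rule landau_o.big.compose)
  have S_summable: "summable (\<lambda>n. airy_primitive_coeff n * w ^ n)" for w
  proof (cases "w = 0")
    case False
    have "summable (\<lambda>n. airy_primitive_coeff n * w ^ Suc n / w)"
      by (intro summable_divide summable_airy_primitive)
    then show ?thesis using False by simp
  qed (auto intro!: summable_finite[of "{0}"])
  \<comment> \<open>Only two terms were subtracted, yet the error is cubic because the coefficient
    at index 2 vanishes.\<close>
  have "eS \<in> O[at 0](\<lambda>y. y ^ 3)"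
    using powser_minus_partial_sum_bigo[OF S_summable, of 3]
    unfolding S_def[symmetric] eS_def[abs_def] by (simp add: lessThan_Suc numeral_3_eq_3 b(3)[unfolded numeral_2_eq_2] add.commute)
  then have eS: "eS \<in> O[at_right 0](\<lambda>w. w ^ 3)"
    by (rule landau_o.big.filter_mono[rotated]) (simp add: at_le)
  have S: "airy_primitive w = w * S w" for w
    unfolding airy_primitive_def S_def using suminf_mult[OF S_summable, of w w] by (simp add: mult_ac)
  have eq: "- bessel_K_primitive w - (Gamma (2 / 3) / w + 3 / 4 * Gamma (2 / 3) * w\<^sup>2) =
     sqrt 3 * (2 * pi / 3 * (e1 (w ^ 3) / w - w * e5 (w ^ 3)) - w * eS w)" if w: "w > 0" for w
  proof -
    have f: "clifford (1 / 3) (w ^ 3) = e1 (w ^ 3) + sqrt 3 * G / (2 * pi) + 3 * sqrt 3 * G / (2 * pi) * w ^ 3"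
      "clifford (5 / 3) (w ^ 3) = e5 (w ^ 3) + 3 / (2 * G)"
      by (simp_all add: e1_def e5_def r)
    have fS: "S w = eS w + (- pi / G + 3 * sqrt 3 / 4 * G * w)"
      unfolding eS_def b by simp
    have "- bessel_K_primitive w = sqrt 3 * (2 * (pi / 3 * (e1 (w ^ 3) + sqrt 3 * G / (2 * pi) + 3 * sqrt 3 * G / (2 * pi) * w ^ 3
        - w\<^sup>2 * (e5 (w ^ 3) + 3 / (2 * G)))) / w - w * (eS w + (- pi / G + 3 * sqrt 3 / 4 * G * w)))"
      unfolding bessel_K_primitive_def S airy_slope_def f fS
      by (simp only: mult_minus_right[symmetric] minus_diff_eq)
    also have "\<dots> = sqrt 3 * (2 * pi / 3 * (e1 (w ^ 3) / w - w * e5 (w ^ 3)) - w * eS w)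
        + sqrt 3 * sqrt 3 * (G / 3 / w + G / 4 * w\<^sup>2)"
    proof -
      have sqrt3: "sqrt 3 * (sqrt 3 * y) = 3 * y" for y :: real by (simp flip: mult.assoc)
      show ?thesis using w G by (simp add: sqrt3 field_simps power2_eq_square power3_eq_cube)
    qed
    finally show ?thesis by (simp add: G_def[symmetric])
  qed
  have "(\<lambda>w. e1 (w ^ 3) / w) \<in> O[at_right 0](\<lambda>w. (w ^ 3) ^ 2 / w)"
    by (intro landau_o.big.divide_right e1 eventually_at_right_less[THEN eventually_mono]) auto
  also have "(\<lambda>w::real. (w ^ 3) ^ 2 / w) \<in> O[at_right 0](\<lambda>w. w ^ 4)" by real_asymp
  finally have 1: "(\<lambda>w. e1 (w ^ 3) / w) \<in> O[at_right 0](\<lambda>w. w ^ 4)" .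
  have "(\<lambda>w. w * e5 (w ^ 3)) \<in> O[at_right 0](\<lambda>w. w * (w ^ 3) ^ 1)"
    by (intro landau_o.big.mult_left e5)
  then have 2: "(\<lambda>w. w * e5 (w ^ 3)) \<in> O[at_right 0](\<lambda>w. w ^ 4)" by (simp add: eval_nat_numeral)
  have "(\<lambda>w. w * eS w) \<in> O[at_right 0](\<lambda>w. w * w ^ 3)"
    by (intro landau_o.big.mult_left eS)
  then have 3: "(\<lambda>w. w * eS w) \<in> O[at_right 0](\<lambda>w. w ^ 4)" by (simp add: eval_nat_numeral)
  have "(\<lambda>w. sqrt 3 * (2 * pi / 3 * (e1 (w ^ 3) / w - w * e5 (w ^ 3)) - w * eS w)) \<in> O[at_right 0](\<lambda>w. w ^ 4)"
    using 1 2 3 by (intro sum_in_bigo landau_o.big.cmult_in_iff[THEN iffD2]) auto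
  moreover have "\<forall>\<^sub>F w in at_right 0. - bessel_K_primitive w - (Gamma (2 / 3) / w + 3 / 4 * Gamma (2 / 3) * w\<^sup>2) =
     sqrt 3 * (2 * pi / 3 * (e1 (w ^ 3) / w - w * e5 (w ^ 3)) - w * eS w)"
    using eventually_at_right_less[of 0] by eventually_elim (rule eq)
  ultimately show ?thesis by (subst landau_o.big.in_cong)
qed

theorem mainTheorem3:
  "(\<lambda>x. synchrotron x -
      (2 powr (2 / 3) * Gamma (2 / 3) * x powr (1 / 3) - pi / sqrt 3 * x
        + 3 * Gamma (2 / 3) / 4 powr (5 / 3) * x powr (7 / 3)))
    \<in> O[at_right 0](\<lambda>x. x powr (11 / 3))"
proof -
  let ?w = "\<lambda>x::real. (x / 2) powr (2 / 3)"
  let ?e = "\<lambda>w. - bessel_K_primitive w - (Gamma (2 / 3) / w + 3 / 4 * Gamma (2 / 3) * w\<^sup>2)"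
  have "filterlim ?w (at_right 0) (at_right 0)" by real_asymp
  with bessel_K_primitive_expansion
  have "(\<lambda>x. ?e (?w x)) \<in> O[at_right 0](\<lambda>x. ?w x ^ 4)" by (rule landau_o.big.compose)
  \<comment> \<open>The fourth power of w is of order x^(8/3), so the factor x produces the exponent
    11/3.\<close>
  then have "(\<lambda>x. x * ?e (?w x)) \<in> O[at_right 0](\<lambda>x. x * ?w x ^ 4)" by (rule landau_o.big.mult_left)
  also have "(\<lambda>x. x * ?w x ^ 4) \<in> O[at_right 0](\<lambda>x. x powr (11 / 3))" by real_asymp
  finally have "(\<lambda>x. x * ?e (?w x)) \<in> O[at_right 0](\<lambda>x. x powr (11 / 3))" .
  \<comment> \<open>For positive x this is an exact identity: the limit of the antiderivative at
    infinity supplies the linear term, and 1 / w and w^2 supply the other two.\<close>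
  moreover have "synchrotron x -
      (2 powr (2 / 3) * Gamma (2 / 3) * x powr (1 / 3) - pi / sqrt 3 * x
        + 3 * Gamma (2 / 3) / 4 powr (5 / 3) * x powr (7 / 3)) = x * ?e (?w x)" if x: "x > 0" for x
  proof -
    have 1: "x / ?w x = 2 powr (2 / 3) * x powr (1 / 3)"
    proof -
      have "x powr 1 / x powr (2 / 3) = x powr (1 / 3)" unfolding powr_diff[symmetric] by simp
      then show ?thesis using x by (simp add: powr_divide field_simps)
    qed
    have 2: "x * (?w x)\<^sup>2 * (3 / 4) = 3 / 4 powr (5 / 3) * x powr (7 / 3)"
    proof -
      have "(?w x)\<^sup>2 = (x / 2) powr (4 / 3)"
        unfolding power2_eq_square powr_add[symmetric] by simp
      also have "\<dots> = x powr (4 / 3) / 2 powr (4 / 3)" using x by (simp add: powr_divide)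
      finally have "x * (?w x)\<^sup>2 * (3 / 4) = (x powr 1 * x powr (4 / 3)) * (3 / (4 * 2 powr (4 / 3)))"
        using x by simp
      also have "x powr 1 * x powr (4 / 3) = x powr (7 / 3)" unfolding powr_add[symmetric] by simp
      also have "4 * 2 powr (4 / 3) = (4 :: real) powr (5 / 3)"
      proof -
        have "(4 :: real) powr (5 / 3) = (2 powr 2) powr (5 / 3)" by simp
        also have "\<dots> = 2 powr 2 * 2 powr (4 / 3)" unfolding powr_powr powr_add[symmetric] by simp
        finally show ?thesis by simp
      qed
      finally show ?thesis by simp
    qed
    have "x * ?e (?w x) = - (x * bessel_K_primitive (?w x)) - (Gamma (2 / 3) * (x / ?w x) + Gamma (2 / 3) * (x * (?w x)\<^sup>2 * (3 / 4)))"
      by (simp add: algebra_simps)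
    then show ?thesis
      unfolding synchrotron_def integral_bessel_K_five_thirds[OF x] 1 2 by (simp add: algebra_simps)
  qed
  then have "\<forall>\<^sub>F x in at_right 0. synchrotron x -
      (2 powr (2 / 3) * Gamma (2 / 3) * x powr (1 / 3) - pi / sqrt 3 * x
        + 3 * Gamma (2 / 3) / 4 powr (5 / 3) * x powr (7 / 3)) = x * ?e (?w x)"
    using eventually_at_right_less[of "0 :: real"] by (rule eventually_mono[rotated])
  ultimately show ?thesis by (subst landau_o.big.in_cong)
qed

end
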